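(* If $D=D(w)$ is the Rothe diagram of a permutation $w\in S_n$, then $\mathscr S_D(\mathbf x;\mathbf y)=\mathfrak S_w(\mathbf x;-\mathbf y)$.
   Context: Notation: $[n]=\{1,\dots,n\}$; $ws_i$ is $w$ with the values $w(i),w(i+1)$ swapped. Operators. On polynomials in $x_1,\dots,x_n$ and variables $y_j$ ($j\in\mathbb Z$), for $i\in[n-1]$ let $s_i$ swap $x_i,x_{i+1}$ and set $\partial_i(f)=\frac{f-s_if}{x_i-x_{i+1}}$, $\pi_{i,j}(f)=\partial_i((x_i+y_j)f)$. For $i\in[n]$ and a finite set $M$ of positive integers, $\omega_i^M=\prod_{a\in[i],\,m\in M}(x_a+y_m)$. Double Schubert polynomials. With $w_0\in S_n$ the longest permutation, $\mathfrak S_{w_0}(\mathbf x;\mathbf y)=\prod_{i+j\le n}(x_i-y_j)$ and $\mathfrak S_w=\partial_i\mathfrak S_{ws_i}$ if $\ell(w)<\ell(ws_i)$. $\mathfrak S_w(\mathbf x;-\mathbf y)$ is obtained by $y_j\mapsto-y_j$. Diagrams. A diagram is a subset $D\subseteq[n]\times[m]$ with columns $D_j=\{i\in[n]:(i,j)\in D\}$. The Rothe diagram of $w\in S_n$ is $D(w)=\{(i,j)\in[n]\times[n]: i<w^{-1}(j),\ j<w(i)\}$. $D$ is \%-avoiding if whenever $i_1<i_2$, $j_1<j_2$, $i_2\in D_{j_1}$ and $i_1\in D_{j_2}$, then $i_1\in D_{j_1}$ or $i_2\in D_{j_2}$; Rothe diagrams are \%-avoiding. Double orthodontic sequence of a \%-avoiding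 diagram $D$. Set $K_i=\{j: D_j=[i]\}$ for $i\in[n]$, and let $D_-$ be $D$ with all these columns replaced by empty columns. A missing tooth of a column $C\subseteq[n]$ is $i\in[n-1]$ with $i\notin C$, $i+1\in C$. If the current diagram $E$ (initially $E=D_-$) is nonempty, perform the $k$-th orthodontic step ($k=1,2,\dots$): let $E_j$ be the leftmost nonempty column of $E$, let $i_k$ be its smallest missing tooth, and let $j_k=j-\#\{a\le i_k: a\notin E_j\}$; swap rows $i_k$ and $i_k+1$ of $E$ to get $E'$; let $M_k=\{j:E'_j=[i_k]\}$; let $E''$ be $E'$ with the columns equal to $[i_k]$ replaced by empty columns, and continue with $E''$. Stop when the diagram is empty (this always happens after finitely many steps); $\ell$ is the number of steps. Then $$\mathscr S_D(\mathbf x;\mathbf y)=\omega_1^{K_1}\cdots\omega_n^{K_n}\,\pi_{i_1,j_1}\bigl(\omega_{i_1}^{M_1}\,\pi_{i_2,j_2}(\omega_{i_2}^{M_2}\cdots\pi_{i_\ell,j_\ell}(\omega_{i_\ell}^{M_\ell})\cdots)\bigr).$$ *)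

theory Defs
  imports "HOL-Library.Poly_Mapping" "HOL-Combinatorics.Permutations"
begin

section \<open>Polynomials in the variables x and y\<close>

text \<open>Only finitely many of the variables occur in any one polynomial, so a single polynomial ring
  serves all \<open>n\<close>. The indices of the \<open>y\<close>-variables are integers.\<close>

datatype xy = X nat | Y int

instantiation xy :: linorder
begin

fun less_eq_xy :: "xy \<Rightarrow> xy \<Rightarrow> bool" where
  "less_eq_xy (X i) (X j) = (i \<le> j)"
| "less_eq_xy (X i) (Y j) = True"
| "less_eq_xy (Y i) (X j) = False"
| "less_eq_xy (Y i) (Y j) = (i \<le> j)"

definition less_xy :: "xy \<Rightarrow> xy \<Rightarrow> bool" where
  "less_xy u v \<longleftrightarrow> u \<le> v \<and> \<not> v \<le> u"

instance
proof
  fix u v w :: xy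
  show "u < v \<longleftrightarrow> u \<le> v \<and> \<not> v \<le> u" by (rule less_xy_def)
  show "u \<le> u" by (cases u) auto
  show "u \<le> w" if "u \<le> v" "v \<le> w" using that by (cases u; cases v; cases w) auto
  show "u = v" if "u \<le> v" "v \<le> u" using that by (cases u; cases v) auto
  show "u \<le> v \<or> v \<le> u" by (cases u; cases v) auto
qed

end

text \<open>Monomials are exponent vectors, polynomials are finitely supported families of integer
  coefficients. The order on variables is only needed to see that this ring is an integral domain.\<close>

type_synonym xy_poly = "(xy \<Rightarrow>\<^sub>0 nat) \<Rightarrow>\<^sub>0 int"

definition var :: "xy \<Rightarrow> xy_poly" where
  "var v = Poly_Mapping.single (Poly_Mapping.single v 1) 1"

abbreviation xv :: "nat \<Rightarrow> xy_poly" where "xv i \<equiv> var (X i)"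
abbreviation yv :: "int \<Rightarrow> xy_poly" where "yv j \<equiv> var (Y j)"

definition subst :: "(xy \<Rightarrow> xy_poly) \<Rightarrow> xy_poly \<Rightarrow> xy_poly" where
  "subst \<sigma> f = (\<Sum>m\<in>Poly_Mapping.keys f. of_int (Poly_Mapping.lookup f m) *
     (\<Prod>v\<in>Poly_Mapping.keys m. \<sigma> v ^ Poly_Mapping.lookup m v))"

definition swap_x :: "nat \<Rightarrow> xy_poly \<Rightarrow> xy_poly" where
  "swap_x i = subst (\<lambda>v. case v of X k \<Rightarrow> xv (transpose i (Suc i) k) | Y j \<Rightarrow> yv j)"

definition negate_y :: "xy_poly \<Rightarrow> xy_poly" where
  "negate_y = subst (\<lambda>v. case v of X k \<Rightarrow> xv k | Y j \<Rightarrow> - yv j)"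

text \<open>The quotient exists and is unique, see \<open>divided_difference_eq\<close> and
  \<open>divided_difference_unique\<close> below.\<close>

definition divided_difference :: "nat \<Rightarrow> xy_poly \<Rightarrow> xy_poly" where
  "divided_difference i f = (THE g. (xv i - xv (Suc i)) * g = f - swap_x i f)"

definition pi_op :: "nat \<Rightarrow> int \<Rightarrow> xy_poly \<Rightarrow> xy_poly" where
  "pi_op i j f = divided_difference i ((xv i + yv j) * f)"

definition omega :: "nat \<Rightarrow> nat set \<Rightarrow> xy_poly" where
  "omega i M = (\<Prod>a\<in>{1..i}. \<Prod>m\<in>M. xv a + yv (int m))"

lemma poly_mapping_eq_sum_single:
  "(\<Sum>k\<in>Poly_Mapping.keys f. Poly_Mapping.single k (Poly_Mapping.lookup f k)) = f"
proof (rule poly_mapping_eqI)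
  fix m
  have "(\<Sum>k\<in>Poly_Mapping.keys f. Poly_Mapping.lookup (Poly_Mapping.single k (Poly_Mapping.lookup f k)) m) =
     (\<Sum>k\<in>Poly_Mapping.keys f. if k = m then Poly_Mapping.lookup f m else 0)"
    by (rule sum.cong) (auto simp: lookup_single)
  then show "Poly_Mapping.lookup (\<Sum>k\<in>Poly_Mapping.keys f. Poly_Mapping.single k (Poly_Mapping.lookup f k)) m =
      Poly_Mapping.lookup f m"
    by (auto simp: lookup_sum in_keys_iff)
qed

lemma single_eq_prod_var:
  "Poly_Mapping.single m 1 = (\<Prod>v\<in>Poly_Mapping.keys m. var v ^ Poly_Mapping.lookup m v)"
proof -
  have pow: "var v ^ k = Poly_Mapping.single (Poly_Mapping.single v k) 1" for v k
  proof (induction k)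
    case (Suc k)
    then show ?case
      by (simp add: var_def mult_single flip: single_add)
  qed simp
  have "(\<Prod>v\<in>A. Poly_Mapping.single (g v) 1) = (Poly_Mapping.single (\<Sum>v\<in>A. g v) 1 :: xy_poly)"
    if "finite A" for A :: "xy set" and g
    using that by induction (auto simp: mult_single)
  then show ?thesis
    by (simp add: pow poly_mapping_eq_sum_single)
qed

lemma subst_var: "subst var f = f"
proof -
  have "of_int c * Poly_Mapping.single m 1 = (Poly_Mapping.single m c :: xy_poly)" for c m
    by (simp add: mult_single flip: single_of_int)
  then show ?thesis
    by (simp add: subst_def poly_mapping_eq_sum_single flip: single_eq_prod_var)
qed

lemma dvd_diff_prod:
  fixes f g :: "'a \<Rightarrow> 'b::comm_ring_1"
  assumes "\<And>v. v \<in> A \<Longrightarrow> d dvd f v - g v"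
  shows "d dvd (\<Prod>v\<in>A. f v) - (\<Prod>v\<in>A. g v)"
  using assms
proof (induction A rule: infinite_finite_induct)
  case (insert v A)
  have "(\<Prod>u\<in>insert v A. f u) - (\<Prod>u\<in>insert v A. g u) =
     (f v - g v) * (\<Prod>u\<in>A. f u) + g v * ((\<Prod>u\<in>A. f u) - (\<Prod>u\<in>A. g u))"
    using insert.hyps by (simp add: algebra_simps)
  moreover have "d dvd f v - g v" "d dvd (\<Prod>u\<in>A. f u) - (\<Prod>u\<in>A. g u)"
    using insert by auto
  ultimately show ?case
    by (metis dvd_add dvd_mult dvd_mult2)
qed auto

lemma dvd_diff_swap_x: "xv i - xv (Suc i) dvd f - swap_x i f"
proof -
  let ?d = "xv i - xv (Suc i)"
  define \<sigma> where "\<sigma> v = (case v of X k \<Rightarrow> xv (transpose i (Suc i) k) | Y j \<Rightarrow> yv j)" for v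
  have var: "?d dvd var v - \<sigma> v" for v
  proof (cases v)
    case (X k)
    have "xv (Suc i) - xv i = ?d * (- 1)" by simp
    then have "?d dvd xv (Suc i) - xv i" by (metis dvd_triv_left)
    with X show ?thesis by (auto simp: \<sigma>_def transpose_def)
  qed (auto simp: \<sigma>_def)
  have pow: "?d dvd var v ^ k - \<sigma> v ^ k" for v k
    using dvd_diff_prod[of "{..<k}" ?d "\<lambda>_. var v" "\<lambda>_. \<sigma> v"] var by simp
  have "f - swap_x i f = subst var f - subst \<sigma> f"
    by (simp add: subst_var swap_x_def \<sigma>_def[abs_def])
  also have "?d dvd \<dots>"
    unfolding subst_def sum_subtractf[symmetric] right_diff_distrib[symmetric]
    by (intro dvd_sum dvd_mult dvd_diff_prod pow)
  finally show ?thesis .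
qed

lemma x_diff_nonzero: "xv i - xv (Suc i) \<noteq> 0"
proof
  assume "xv i - xv (Suc i) = 0"
  then have "Poly_Mapping.lookup (xv i) (Poly_Mapping.single (X i) 1) =
      Poly_Mapping.lookup (xv (Suc i)) (Poly_Mapping.single (X i) 1)" by simp
  moreover have "Poly_Mapping.single (X (Suc i)) (1::nat) \<noteq> Poly_Mapping.single (X i) 1"
    by (metis lookup_single_eq lookup_single_not_eq n_not_Suc_n xy.inject(1) zero_neq_one)
  ultimately show False by (simp add: var_def lookup_single)
qed

lemma divided_difference_unique:
  "(xv i - xv (Suc i)) * g = f - swap_x i f \<Longrightarrow> divided_difference i f = g"
  unfolding divided_difference_def
proof (rule the_equality)
  fix h
  assume "(xv i - xv (Suc i)) * g = f - swap_x i f" "(xv i - xv (Suc i)) * h = f - swap_x i f"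
  then have "(xv i - xv (Suc i)) * h = (xv i - xv (Suc i)) * g" by simp
  with x_diff_nonzero show "h = g" by (metis mult_left_cancel)
qed

lemma divided_difference_eq:
  "(xv i - xv (Suc i)) * divided_difference i f = f - swap_x i f"
  using dvd_diff_swap_x[of i f] divided_difference_unique by (metis dvdE)


section \<open>Double Schubert polynomials\<close>

text \<open>Elements of \<open>S\<^sub>n\<close> are functions \<open>w\<close> with \<open>w permutes {1..n}\<close>.\<close>

definition perm_length :: "nat \<Rightarrow> (nat \<Rightarrow> nat) \<Rightarrow> nat" where
  "perm_length n w = card {(i, j). 1 \<le> i \<and> i < j \<and> j \<le> n \<and> w i > w j}"

definition longest_perm :: "nat \<Rightarrow> nat \<Rightarrow> nat" where
  "longest_perm n i = (if i \<in> {1..n} then n + 1 - i else i)"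

text \<open>The defining recursion may descend through any \<open>i\<close> with \<open>\<ell>(w) < \<ell>(w s\<^sub>i)\<close>. That the result
  does not depend on the choices (the braid relations for divided differences) is what makes the
  description below denote.\<close>

inductive is_double_schubert :: "nat \<Rightarrow> (nat \<Rightarrow> nat) \<Rightarrow> xy_poly \<Rightarrow> bool" for n where
  longest: "is_double_schubert n (longest_perm n)
    (\<Prod>(i, j)\<in>{(i, j). 1 \<le> i \<and> 1 \<le> j \<and> i + j \<le> n}. xv i - yv (int j))"
| descend: "is_double_schubert n w (divided_difference i f)"
    if "w permutes {1..n}" "i \<in> {1..<n}"
      "perm_length n w < perm_length n (w \<circ> transpose i (Suc i))"
      "is_double_schubert n (w \<circ> transpose i (Suc i)) f"

definition double_schubert :: "nat \<Rightarrow> (nat \<Rightarrow> nat) \<Rightarrow> xy_poly" where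
  "double_schubert n w = (THE f. is_double_schubert n w f)"


section \<open>Diagrams\<close>

type_synonym diagram = "(nat \<times> nat) set"

definition column :: "diagram \<Rightarrow> nat \<Rightarrow> nat set" where
  "column D j = {i. (i, j) \<in> D}"

definition percent_avoiding :: "diagram \<Rightarrow> bool" where
  "percent_avoiding D \<longleftrightarrow> (\<forall>i1 i2 j1 j2. i1 < i2 \<longrightarrow> j1 < j2 \<longrightarrow>
     i2 \<in> column D j1 \<longrightarrow> i1 \<in> column D j2 \<longrightarrow> i1 \<in> column D j1 \<or> i2 \<in> column D j2)"

definition rothe_diagram :: "nat \<Rightarrow> (nat \<Rightarrow> nat) \<Rightarrow> diagram" where
  "rothe_diagram n w = {(i, j). i \<in> {1..n} \<and> j \<in> {1..n} \<and> i < inv w j \<and> j < w i}"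

lemma rothe_diagram_percent_avoiding: "percent_avoiding (rothe_diagram n w)"
  unfolding percent_avoiding_def column_def rothe_diagram_def by auto


section \<open>The double orthodontic sequence\<close>

definition missing_teeth :: "nat \<Rightarrow> nat set \<Rightarrow> nat set" where
  "missing_teeth n C = {i \<in> {1..<n}. i \<notin> C \<and> Suc i \<in> C}"

definition swap_rows :: "nat \<Rightarrow> diagram \<Rightarrow> diagram" where
  "swap_rows i E = map_prod (transpose i (Suc i)) id ` E"

text \<open>\<open>orthodontic_sequence n E ss\<close> states that the orthodontic steps carried out from the current
  diagram \<open>E\<close> terminate and produce the list \<open>ss\<close> of triples \<open>(i\<^sub>k, j\<^sub>k, M\<^sub>k)\<close>. The number \<open>j\<^sub>k\<close> is a
  difference of integers; it is not truncated at zero.\<close>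

inductive orthodontic_sequence :: "nat \<Rightarrow> diagram \<Rightarrow> (nat \<times> int \<times> nat set) list \<Rightarrow> bool" for n where
  stop: "orthodontic_sequence n {} []"
| step: "orthodontic_sequence n E ((i, jk, M) # ss)"
    if "E \<noteq> {}"
      "j = (LEAST j. column E j \<noteq> {})"
      "missing_teeth n (column E j) \<noteq> {}"
      "i = Min (missing_teeth n (column E j))"
      "jk = int j - int (card {a \<in> {1..i}. a \<notin> column E j})"
      "E' = swap_rows i E"
      "M = {c. column E' c = {1..i}}"
      "orthodontic_sequence n {(a, c) \<in> E'. c \<notin> M} ss"

lemma orthodontic_sequence_unique:
  "orthodontic_sequence n E ss \<Longrightarrow> orthodontic_sequence n E ss' \<Longrightarrow> ss = ss'"
proof (induction arbitrary: ss' rule: orthodontic_sequence.induct)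
  case stop
  then show ?case by (auto elim: orthodontic_sequence.cases)
next
  case step
  from step.prems step.IH step.hyps show ?case
    by (cases rule: orthodontic_sequence.cases) auto
qed

definition interval_columns :: "diagram \<Rightarrow> nat \<Rightarrow> nat set" where
  "interval_columns D i = {j. column D j = {1..i}}"

definition reduced_diagram :: "nat \<Rightarrow> diagram \<Rightarrow> diagram" where
  "reduced_diagram n D = {(a, j) \<in> D. \<forall>i\<in>{1..n}. j \<notin> interval_columns D i}"

text \<open>Meaningful for \<open>%\<close>-avoiding \<open>D \<subseteq> {1..n} \<times> {1..m}\<close>.\<close>

definition double_orthodontia_poly :: "nat \<Rightarrow> diagram \<Rightarrow> xy_poly" where
  "double_orthodontia_poly n D =
     (\<Prod>i\<in>{1..n}. omega i (interval_columns D i)) *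
     foldr (\<lambda>(i, j, M) f. pi_op i j (omega i M * f))
       (THE ss. orthodontic_sequence n (reduced_diagram n D) ss) 1"

end

theory Submission
  imports Defs
begin

text \<open>
Write \<open>D\<close> for the Rothe diagram of \<open>w\<close>, \<open>E\<close> for the diagram of its columns that are not intervals
\<open>[m]\<close>, and \<open>G\<close> for the value of the orthodontic expression of \<open>E\<close>. The factors \<open>\<omega>\<close> in front of
\<open>G\<close> amount to one factor \<open>x\<^sub>a + y\<^sub>c\<close> for each box \<open>(a, c)\<close> of an interval column of \<open>D\<close>; let \<open>F\<close>
be their product. The claim is that \<open>F * G\<close> is the Schubert polynomial with all \<open>y\<close> negated, and it
is proved by walking up in the weak order to the longest permutation.

Every step of the walk goes from \<open>w\<close> to \<open>v = w s\<^sub>i\<close>, where \<open>w(i)\<close> is a left-to-right minimum followed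
by an ascent. Then \<open>D\<close> changes in the simplest way: rows \<open>i\<close> and \<open>i + 1\<close> are swapped and column
\<open>w(i)\<close> grows from \<open>[i - 1]\<close> to \<open>[i]\<close>. So \<open>F\<close> is symmetric in \<open>x\<^sub>i, x\<^sub>i\<^sub>+\<^sub>1\<close> and acquires the factor
\<open>x\<^sub>i + y\<^sub>w\<^sub>(\<^sub>i\<^sub>)\<close> together with \<open>\<omega>\<^sub>i\<close> of the columns that have just become \<open>[i]\<close>
(\<open>box_prod_v\<close>, \<open>swap_x_box_prod\<close>). Since \<open>\<SS>\<^sub>w = \<partial>\<^sub>i \<SS>\<^sub>v\<close>, the factor \<open>F\<close> can be moved out of the
divided difference, and what is left is \<open>\<pi>\<close> with indices \<open>i\<close> and \<open>w(i)\<close>, applied to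
\<open>\<omega>\<^sub>i G(v)\<close>.

Which \<open>i\<close> to take is dictated by orthodontia. Let \<open>j\<close> be the leftmost column of \<open>E\<close> and \<open>i\<close> its
first missing tooth. The columns to the left of \<open>j\<close> are intervals, which forces the rows
\<open>a \<le> i\<close> missing from column \<open>j\<close> to be consecutive, to end in \<open>i\<close>, and to carry exactly the values
just below \<open>j\<close>; call these rows the gap.

If \<open>w\<close> is decreasing on the gap, then \<open>w(i)\<close> is a left-to-right minimum and equals the index
prescribed for \<open>\<pi>\<close>, so that the step from \<open>w\<close> to \<open>w s\<^sub>i\<close> is the orthodontic step (\<open>card_gap\<close>,
\<open>orthodontic_sequence_step\<close>).

Otherwise take the first ascent \<open>a\<close> inside the gap. No column of \<open>E\<close> distinguishes the rows \<open>a\<close> and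
\<open>a + 1\<close>, so \<open>E\<close> and \<open>G\<close> are unchanged, and the formula passes from \<open>w s\<^sub>a\<close> to \<open>w\<close> as soon as \<open>G\<close> is
symmetric in \<open>x\<^sub>a, x\<^sub>a\<^sub>+\<^sub>1\<close>. This symmetry in the gap (\<open>symmetric_in_gap_if_fewer_steps\<close>) is the heart
of the matter. Only its case \<open>a = i - 1\<close> is substantial. There \<open>G = \<pi>\<^sub>i \<pi>\<^sub>i\<^sub>-\<^sub>1 H\<close>, and the braid relation
gives the symmetry provided that \<open>H\<close> is symmetric in \<open>x\<^sub>i, x\<^sub>i\<^sub>+\<^sub>1\<close> (\<open>swap_x_pi_op_pi_op\<close>). To see the
latter, choose a permutation \<open>u\<close> with the same reduced diagram as after these two steps but with an
ascent at \<open>i\<close>: its orthodontic sequence is shorter, so the theorem holds for \<open>u\<close> by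
induction, and its Schubert polynomial is symmetric in \<open>x\<^sub>i, x\<^sub>i\<^sub>+\<^sub>1\<close> because it is a value of \<open>\<partial>\<^sub>i\<close>.

If \<open>E\<close> is empty, then \<open>G = 1\<close>, and the first ascent of \<open>w\<close> leads to another permutation with empty \<open>E\<close>,
until the longest permutation is reached.

That Schubert polynomials may be computed through these particular ascents rests on their independence of
the chosen descents, which follows from the commutation and braid relations of the divided
differences (\<open>divided_difference_local_confluence\<close>).
\<close>

section \<open>Substitution is a ring homomorphism\<close>

definition eval_monom :: "(xy \<Rightarrow> xy_poly) \<Rightarrow> (xy \<Rightarrow>\<^sub>0 nat) \<Rightarrow> xy_poly" where
  "eval_monom \<sigma> m = (\<Prod>v\<in>Poly_Mapping.keys m. \<sigma> v ^ Poly_Mapping.lookup m v)"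

lemma eval_monom_superset:
  assumes "finite A" "Poly_Mapping.keys m \<subseteq> A"
  shows "eval_monom \<sigma> m = (\<Prod>v\<in>A. \<sigma> v ^ Poly_Mapping.lookup m v)"
  unfolding eval_monom_def
  by (rule prod.mono_neutral_left) (use assms in \<open>auto simp: in_keys_iff\<close>)

lemma eval_monom_add: "eval_monom \<sigma> (m + m') = eval_monom \<sigma> m * eval_monom \<sigma> m'"
proof -
  let ?A = "Poly_Mapping.keys m \<union> Poly_Mapping.keys m'"
  have "Poly_Mapping.keys (m + m') \<subseteq> ?A"
    by (rule Poly_Mapping.keys_add)
  then show ?thesis
    by (simp add: eval_monom_superset[of ?A] lookup_add power_add prod.distrib)
qed

lemma subst_superset:
  assumes "finite A" "Poly_Mapping.keys f \<subseteq> A"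
  shows "subst \<sigma> f = (\<Sum>m\<in>A. of_int (Poly_Mapping.lookup f m) * eval_monom \<sigma> m)"
  unfolding subst_def eval_monom_def
  by (rule sum.mono_neutral_left) (use assms in \<open>auto simp: in_keys_iff\<close>)

lemma subst_add: "subst \<sigma> (f + g) = subst \<sigma> f + subst \<sigma> g"
proof -
  let ?A = "Poly_Mapping.keys f \<union> Poly_Mapping.keys g"
  have "Poly_Mapping.keys (f + g) \<subseteq> ?A"
    by (rule Poly_Mapping.keys_add)
  then show ?thesis
    by (simp add: subst_superset[of ?A] lookup_add algebra_simps sum.distrib)
qed

lemma subst_single: "subst \<sigma> (Poly_Mapping.single m c) = of_int c * eval_monom \<sigma> m"
  by (simp add: subst_superset[of "{m}"])

lemma subst_0: "subst \<sigma> 0 = 0"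
  by (simp add: subst_def)

lemma subst_1: "subst \<sigma> 1 = 1"
  using subst_single[of \<sigma> 0 1] by (simp add: eval_monom_def)

lemma subst_sum: "subst \<sigma> (\<Sum>k\<in>A. f k) = (\<Sum>k\<in>A. subst \<sigma> (f k))"
  by (induction A rule: infinite_finite_induct) (auto simp: subst_add subst_0)

lemma subst_mult: "subst \<sigma> (f * g) = subst \<sigma> f * subst \<sigma> g"
proof -
  have expand: "f' = (\<Sum>k\<in>Poly_Mapping.keys f'. Poly_Mapping.single k (Poly_Mapping.lookup f' k))"
    for f' :: xy_poly by (rule poly_mapping_eq_sum_single[symmetric])
  have "f * g = (\<Sum>k\<in>Poly_Mapping.keys f. \<Sum>l\<in>Poly_Mapping.keys g.
      Poly_Mapping.single (k + l) (Poly_Mapping.lookup f k * Poly_Mapping.lookup g l))"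
    by (subst expand[of f], subst expand[of g]) (simp add: sum_product mult_single)
  also have "subst \<sigma> \<dots> = (\<Sum>k\<in>Poly_Mapping.keys f. of_int (Poly_Mapping.lookup f k) * eval_monom \<sigma> k) *
      (\<Sum>l\<in>Poly_Mapping.keys g. of_int (Poly_Mapping.lookup g l) * eval_monom \<sigma> l)"
    unfolding sum_product
    by (simp add: subst_sum subst_single eval_monom_add algebra_simps)
  finally show ?thesis
    by (simp add: subst_superset[of "Poly_Mapping.keys f"] subst_superset[of "Poly_Mapping.keys g"])
qed

lemma subst_var_apply: "subst \<sigma> (var v) = \<sigma> v"
  by (simp add: var_def subst_single eval_monom_def)

lemma subst_of_int: "subst \<sigma> (of_int c) = of_int c"
  using subst_single[of \<sigma> 0 c] by (simp add: eval_monom_def flip: single_of_int)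

lemma subst_uminus: "subst \<sigma> (- f) = - subst \<sigma> f"
  using subst_add[of \<sigma> f "- f"] by (simp add: subst_0 eq_neg_iff_add_eq_0 add.commute)

lemma subst_diff: "subst \<sigma> (f - g) = subst \<sigma> f - subst \<sigma> g"
  using subst_add[of \<sigma> f "- g"] by (simp add: subst_uminus)

lemma subst_prod: "subst \<sigma> (\<Prod>k\<in>A. f k) = (\<Prod>k\<in>A. subst \<sigma> (f k))"
  by (induction A rule: infinite_finite_induct) (auto simp: subst_mult subst_1)

lemma subst_power: "subst \<sigma> (f ^ k) = subst \<sigma> f ^ k"
  by (induction k) (auto simp: subst_mult subst_1)

lemma subst_subst: "subst \<sigma> (subst \<tau> f) = subst (\<lambda>v. subst \<sigma> (\<tau> v)) f"
  unfolding subst_def[of \<tau> f] subst_def[of "\<lambda>v. subst \<sigma> (\<tau> v)" f]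
  by (simp add: subst_sum subst_mult subst_of_int subst_prod subst_power)

lemmas subst_ring_simps =
  subst_add subst_diff subst_uminus subst_mult subst_prod subst_0 subst_1 subst_var_apply

lemmas swap_x_ring_simps = subst_ring_simps[of "\<lambda>v. case v of X k \<Rightarrow> xv (transpose i (Suc i) k) | Y j \<Rightarrow> yv j" for i,
    folded swap_x_def]

lemma swap_x_xv [simp]: "swap_x i (xv k) = xv (transpose i (Suc i) k)"
  and swap_x_yv [simp]: "swap_x i (yv j) = yv j"
  by (simp_all add: swap_x_def subst_var_apply)

lemma swap_x_swap_x [simp]: "swap_x i (swap_x i f) = f"
proof -
  have "swap_x i (swap_x i f) = subst var f"
    unfolding swap_x_def subst_subst
    by (rule arg_cong[of _ _ "\<lambda>\<sigma>. subst \<sigma> f"]) (auto simp: fun_eq_iff subst_var_apply split: xy.split)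
  then show ?thesis by (simp add: subst_var)
qed

lemma swap_x_commute:
  assumes "Suc i < k"
  shows "swap_x i (swap_x k f) = swap_x k (swap_x i f)"
  unfolding swap_x_def subst_subst
  by (rule arg_cong[of _ _ "\<lambda>\<sigma>. subst \<sigma> f"])
     (use assms in \<open>auto simp: fun_eq_iff subst_var_apply transpose_def split: xy.split\<close>)

lemma swap_x_braid:
  "swap_x i (swap_x (Suc i) (swap_x i f)) = swap_x (Suc i) (swap_x i (swap_x (Suc i) f))"
  unfolding swap_x_def subst_subst
  by (rule arg_cong[of _ _ "\<lambda>\<sigma>. subst \<sigma> f"])
     (auto simp: fun_eq_iff subst_var_apply transpose_def split: xy.split)

lemmas negate_y_ring_simps = subst_ring_simps[of "\<lambda>v. case v of X k \<Rightarrow> xv k | Y j \<Rightarrow> - yv j",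
    folded negate_y_def]

lemma negate_y_xv [simp]: "negate_y (xv k) = xv k"
  and negate_y_yv [simp]: "negate_y (yv j) = - yv j"
  by (simp_all add: negate_y_def subst_var_apply)

lemma negate_y_swap_x: "negate_y (swap_x i f) = swap_x i (negate_y f)"
  unfolding negate_y_def swap_x_def subst_subst
  by (rule arg_cong[of _ _ "\<lambda>\<sigma>. subst \<sigma> f"])
     (auto simp: fun_eq_iff subst_var_apply subst_uminus split: xy.split)

section \<open>Divided differences\<close>

lemma divided_difference_eq_0_iff: "divided_difference i f = 0 \<longleftrightarrow> swap_x i f = f"
  using divided_difference_eq[of i f] x_diff_nonzero[of i]
  by (metis eq_iff_diff_eq_0 mult_eq_0_iff)

lemma swap_x_divided_difference [simp]:
  "swap_x i (divided_difference i f) = divided_difference i f"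
proof -
  let ?g = "divided_difference i f"
  have "swap_x i ((xv i - xv (Suc i)) * ?g) = swap_x i (f - swap_x i f)"
    by (simp add: divided_difference_eq)
  then have "(xv (Suc i) - xv i) * swap_x i ?g = swap_x i f - f"
    by (simp add: swap_x_ring_simps)
  then have "(xv i - xv (Suc i)) * swap_x i ?g = f - swap_x i f"
    by (simp add: algebra_simps)
  then show ?thesis
    using divided_difference_unique by metis
qed

lemma divided_difference_symmetric_mult:
  assumes "swap_x i f = f"
  shows "divided_difference i (f * g) = f * divided_difference i g"
proof (rule divided_difference_unique)
  have "(xv i - xv (Suc i)) * (f * divided_difference i g) = f * (g - swap_x i g)"
    by (simp add: divided_difference_eq[symmetric] algebra_simps)
  then show "(xv i - xv (Suc i)) * (f * divided_difference i g) = f * g - swap_x i (f * g)"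
    by (simp add: assms swap_x_ring_simps algebra_simps)
qed

lemma divided_difference_diff:
  "divided_difference i (f - g) = divided_difference i f - divided_difference i g"
  by (rule divided_difference_unique)
     (simp add: right_diff_distrib divided_difference_eq swap_x_ring_simps)

lemma divided_difference_0 [simp]: "divided_difference i 0 = 0"
  by (rule divided_difference_unique) (simp add: swap_x_ring_simps)

lemma negate_y_divided_difference:
  "negate_y (divided_difference i f) = divided_difference i (negate_y f)"
proof (rule divided_difference_unique[symmetric])
  have "negate_y ((xv i - xv (Suc i)) * divided_difference i f) = negate_y (f - swap_x i f)"
    by (simp add: divided_difference_eq)
  then show "(xv i - xv (Suc i)) * negate_y (divided_difference i f) =
      negate_y f - swap_x i (negate_y f)"
    by (simp add: negate_y_ring_simps negate_y_swap_x)
qed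

lemma swap_x_divided_difference_commute:
  assumes "Suc i < k \<or> Suc k < i"
  shows "swap_x k (divided_difference i f) = divided_difference i (swap_x k f)"
proof (rule divided_difference_unique[symmetric])
  have comm: "swap_x k (swap_x i f) = swap_x i (swap_x k f)"
    using assms swap_x_commute[of i k f] swap_x_commute[of k i f] by auto
  have "swap_x k ((xv i - xv (Suc i)) * divided_difference i f) = swap_x k (f - swap_x i f)"
    by (simp add: divided_difference_eq)
  moreover have "swap_x k (xv i) = xv i" "swap_x k (xv (Suc i)) = xv (Suc i)"
    using assms by (auto simp: transpose_def)
  ultimately show "(xv i - xv (Suc i)) * swap_x k (divided_difference i f) =
      swap_x k f - swap_x i (swap_x k f)"
    by (simp add: swap_x_ring_simps comm del: swap_x_xv)
qed

lemma divided_difference_commute: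
  assumes "Suc i < k"
  shows "divided_difference i (divided_difference k f) = divided_difference k (divided_difference i f)"
proof (rule divided_difference_unique)
  have sym: "swap_x k (xv i - xv (Suc i)) = xv i - xv (Suc i)"
    using assms by (simp add: swap_x_ring_simps transpose_def)
  have "(xv i - xv (Suc i)) * divided_difference k (divided_difference i f) =
      divided_difference k ((xv i - xv (Suc i)) * divided_difference i f)"
    by (rule divided_difference_symmetric_mult[OF sym, symmetric])
  also have "\<dots> = divided_difference k f - swap_x i (divided_difference k f)"
    using assms by (simp add: divided_difference_eq divided_difference_diff swap_x_divided_difference_commute)
  finally show "(xv i - xv (Suc i)) * divided_difference k (divided_difference i f) =
      divided_difference k f - swap_x i (divided_difference k f)" .
qed

lemma xv_diff_nonzero:
  assumes "i \<noteq> k"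
  shows "xv i - xv k \<noteq> 0"
proof
  assume "xv i - xv k = 0"
  then have "subst (\<lambda>v. if v = X i then 1 else 0) (xv i - xv k) = 0"
    by (simp add: subst_0)
  with assms show False
    by (simp add: subst_ring_simps)
qed

text \<open>Clearing denominators turns the threefold divided difference into the antisymmetrization over the
  symmetric group of the three variables. This form is visibly invariant under exchanging the two
  generators, up to the braid relation for the swaps. The denominator \<open>p i + p k\<close> is the difference of
  the two outer variables.\<close>

lemma divided_difference_braid_expansion:
  fixes f :: xy_poly and i k :: nat
  assumes ik: "k = Suc i \<or> i = Suc k"
  defines "p \<equiv> \<lambda>j. xv j - xv (Suc j)"
  shows "p i * p k * (p i + p k) * divided_difference i (divided_difference k (divided_difference i f)) =
    f - swap_x i f - swap_x k f + swap_x i (swap_x k f) + swap_x k (swap_x i f)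
      - swap_x i (swap_x k (swap_x i f))"
proof -
  define h where "h = divided_difference i f"
  define g where "g = divided_difference k h"
  have pk: "swap_x i (p k) = p i + p k" "swap_x k (p i) = p i + p k" "swap_x i (p i) = - p i"
    using ik by (auto simp: p_def swap_x_ring_simps transpose_def)
  have h: "p i * h = f - swap_x i f"
    by (simp add: h_def p_def divided_difference_eq)
  have g: "p k * g = h - swap_x k h"
    by (simp add: g_def p_def divided_difference_eq)
  \<comment> \<open>Each of the next three facts applies a swap to a defining equation of a divided difference, so that
      \<open>g\<close> and \<open>h\<close> can be eliminated without dividing.\<close>
  have sg: "(p i + p k) * swap_x i g = h - swap_x i (swap_x k h)"
  proof -
    have "swap_x i (p k * g) = swap_x i (h - swap_x k h)" by (simp add: g)
    then show ?thesis by (simp add: swap_x_ring_simps pk) (simp add: h_def)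
  qed
  have skh: "(p i + p k) * swap_x k h = swap_x k f - swap_x k (swap_x i f)"
  proof -
    have "swap_x k (p i * h) = swap_x k (f - swap_x i f)" by (simp add: h)
    then show ?thesis by (simp add: swap_x_ring_simps pk)
  qed
  have sskh: "p k * swap_x i (swap_x k h) = swap_x i (swap_x k f) - swap_x i (swap_x k (swap_x i f))"
  proof -
    have "swap_x i ((p i + p k) * swap_x k h) = swap_x i (swap_x k f - swap_x k (swap_x i f))"
      by (simp add: skh)
    then show ?thesis by (simp add: swap_x_ring_simps pk)
  qed
  have dg: "p i * divided_difference i g = g - swap_x i g"
    by (simp add: p_def divided_difference_eq)
  have "p i * p k * (p i + p k) * divided_difference i g =
      p k * (p i + p k) * (p i * divided_difference i g)"
    by (simp only: ac_simps)
  also have "\<dots> = p k * (p i + p k) * (g - swap_x i g)"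
    by (simp only: dg)
  also have "\<dots> = (p i + p k) * (p k * g) - p k * ((p i + p k) * swap_x i g)"
    by (simp add: algebra_simps)
  also have "\<dots> = p i * h - (p i + p k) * swap_x k h + p k * swap_x i (swap_x k h)"
    unfolding g sg by (simp add: algebra_simps)
  finally show ?thesis
    unfolding h skh sskh by (simp add: g_def h_def)
qed

lemma divided_difference_braid:
  "divided_difference i (divided_difference (Suc i) (divided_difference i f)) =
   divided_difference (Suc i) (divided_difference i (divided_difference (Suc i) f))"
proof -
  let ?p = "\<lambda>j. xv j - xv (Suc j)"
  let ?c = "?p i * ?p (Suc i) * (?p i + ?p (Suc i))"
  have "?p i + ?p (Suc i) = xv i - xv (Suc (Suc i))"
    by simp
  then have "?c \<noteq> 0"
    using xv_diff_nonzero[of i "Suc i"] xv_diff_nonzero[of "Suc i" "Suc (Suc i)"]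
      xv_diff_nonzero[of i "Suc (Suc i)"] by (metis lessI less_SucI mult_eq_0_iff nat_neq_iff)
  moreover have "?c * divided_difference i (divided_difference (Suc i) (divided_difference i f)) =
     ?c * divided_difference (Suc i) (divided_difference i (divided_difference (Suc i) f))"
    using divided_difference_braid_expansion[of "Suc i" i f]
      divided_difference_braid_expansion[of i "Suc i" f] swap_x_braid[of i f]
    by (simp add: ac_simps)
  ultimately show ?thesis
    by (metis mult_left_cancel)
qed

section \<open>The operators of the orthodontic formula\<close>

lemma divided_difference_braid_eq_0:
  assumes "swap_x (Suc i) f = f"
  shows "divided_difference i (divided_difference (Suc i) (divided_difference i f)) = 0"
  using assms by (simp add: divided_difference_braid divided_difference_eq_0_iff[THEN iffD2])

text \<open>By the Leibniz rule \<open>\<pi>\<^sub>i\<^sub>+\<^sub>1 \<pi>\<^sub>i h\<close> is \<open>\<partial>\<^sub>i\<^sub>+\<^sub>1 \<partial>\<^sub>i\<close> applied to \<open>(x\<^sub>i + y\<^sub>j) (x\<^sub>i + y\<^sub>k) h\<close>, up to a term that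
  \<open>\<partial>\<^sub>i\<^sub>+\<^sub>1\<close> kills. The braid relation moves \<open>\<partial>\<^sub>i\<^sub>+\<^sub>1\<close> next to this product, which is symmetric in the variables
  \<open>i + 1\<close> and \<open>i + 2\<close>; hence \<open>\<partial>\<^sub>i\<close> of the whole expression vanishes.\<close>

lemma swap_x_pi_op_pi_op:
  assumes sym: "swap_x (Suc i) h = h"
  shows "swap_x i (pi_op (Suc i) j (pi_op i k h)) = pi_op (Suc i) j (pi_op i k h)"
proof -
  define g where "g = (xv i + yv k) * h"
  have symg: "swap_x (Suc i) ((xv i + yv j) * h') = (xv i + yv j) * h'"
    if "swap_x (Suc i) h' = h'" for j h'
    using that by (simp add: swap_x_ring_simps transpose_def)
  have g: "swap_x (Suc i) g = g"
    unfolding g_def by (rule symg[OF sym])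
  have leibniz: "(xv (Suc i) + yv j) * divided_difference i g =
      divided_difference i ((xv i + yv j) * g) - g"
  proof -
    have "divided_difference i ((xv i + yv j) * g) = (xv (Suc i) + yv j) * divided_difference i g + g"
    proof (rule divided_difference_unique)
      have "(xv i - xv (Suc i)) * ((xv (Suc i) + yv j) * divided_difference i g + g) =
          (xv (Suc i) + yv j) * ((xv i - xv (Suc i)) * divided_difference i g) + (xv i - xv (Suc i)) * g"
        by (simp only: distrib_left ac_simps)
      also have "\<dots> = (xv (Suc i) + yv j) * (g - swap_x i g) + (xv i - xv (Suc i)) * g"
        by (simp only: divided_difference_eq)
      finally show "(xv i - xv (Suc i)) * ((xv (Suc i) + yv j) * divided_difference i g + g) =
          (xv i + yv j) * g - swap_x i ((xv i + yv j) * g)"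
        by (simp add: swap_x_ring_simps algebra_simps)
    qed
    then show ?thesis by simp
  qed
  have "divided_difference (Suc i) g = 0"
    using g by (simp add: divided_difference_eq_0_iff)
  then have "pi_op (Suc i) j (pi_op i k h) =
      divided_difference (Suc i) (divided_difference i ((xv i + yv j) * g))"
    unfolding pi_op_def g_def[symmetric] leibniz by (simp add: divided_difference_diff)
  moreover have "divided_difference i (divided_difference (Suc i) (divided_difference i ((xv i + yv j) * g))) = 0"
    by (intro divided_difference_braid_eq_0 symg g)
  ultimately show ?thesis
    by (simp add: divided_difference_eq_0_iff)
qed

lemma swap_x_pi_op_distant:
  assumes "Suc a < i" "swap_x a h = h"
  shows "swap_x a (pi_op i j h) = pi_op i j h"
  using assms by (simp add: pi_op_def swap_x_divided_difference_commute swap_x_ring_simps transpose_def)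

lemma swap_x_omega:
  assumes "a \<noteq> i" "1 \<le> a"
  shows "swap_x a (omega i M) = omega i M"
proof -
  have "transpose a (Suc a) ` {1..i} = {1..i}"
    by (rule transpose_image_eq) (use assms in auto)
  then have "bij_betw (transpose a (Suc a)) {1..i} {1..i}"
    by (metis bij_betw_imageI inj_on_transpose)
  then have "(\<Prod>b\<in>{1..i}. \<Prod>m\<in>M. xv (transpose a (Suc a) b) + yv (int m)) = omega i M"
    unfolding omega_def by (rule prod.reindex_bij_betw)
  then show ?thesis
    by (simp add: omega_def swap_x_ring_simps)
qed

section \<open>Length and ascents\<close>

lemma permutes_comp_transpose:
  assumes "w permutes {1..n}" "i \<in> {1..<n}"
  shows "w \<circ> transpose i (Suc i) permutes {1..n}"
  using assms by (auto intro!: permutes_compose permutes_swap_id)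

lemma comp_transpose_twice [simp]: "w \<circ> transpose i (Suc i) \<circ> transpose i (Suc i) = w"
  by (simp add: fun_eq_iff)

lemma perm_length_ascent:
  assumes i: "i \<in> {1..<n}" and asc: "w i < w (Suc i)"
  shows "perm_length n (w \<circ> transpose i (Suc i)) = Suc (perm_length n w)"
proof -
  define t where "t = transpose i (Suc i)"
  define I where "I w = {(a, b). 1 \<le> a \<and> a < b \<and> b \<le> n \<and> w a > (w b :: nat)}" for w
  have t [simp]: "t i = Suc i" "t (Suc i) = i" "a \<noteq> i \<Longrightarrow> a \<noteq> Suc i \<Longrightarrow> t a = a" "t (t a) = a" for a
    by (simp_all add: t_def)
  have I: "(a, b) \<in> I w \<longleftrightarrow> 1 \<le> a \<and> a < b \<and> b \<le> n \<and> w b < w a" for a b w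
    by (simp add: I_def)
  have fin: "finite (I w)" for w
    by (rule finite_subset[of _ "{..n} \<times> {..n}"]) (auto simp: I_def)
  have mem: "(t a, t b) \<in> I w \<longleftrightarrow> (a, b) \<in> I (w \<circ> t) \<and> (a, b) \<noteq> (i, Suc i)" for a b
  proof -
    have cases: "c = i \<or> c = Suc i \<or> c \<noteq> i \<and> c \<noteq> Suc i" for c by blast
    from cases[of a] show ?thesis
    proof (elim disjE)
      assume "a = i"
      with cases[of b] i asc show ?thesis by (elim disjE) (auto simp: I)
    next
      assume "a = Suc i"
      with cases[of b] i asc show ?thesis by (elim disjE) (auto simp: I)
    next
      assume "a \<noteq> i \<and> a \<noteq> Suc i"
      with cases[of b] i asc show ?thesis by (elim disjE) (auto simp: I)
    qed
  qed
  \<comment> \<open>The swap matches the inversions of \<open>w\<close> with those of the longer permutation, the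
      new one excepted.\<close>
  have "bij_betw (map_prod t t) (I w) (I (w \<circ> t) - {(i, Suc i)})"
  proof (rule bij_betw_byWitness[of _ "map_prod t t"])
    show "map_prod t t ` I w \<subseteq> I (w \<circ> t) - {(i, Suc i)}"
      using mem[of "t a" "t b" for a b] by auto
    show "map_prod t t ` (I (w \<circ> t) - {(i, Suc i)}) \<subseteq> I w"
      using mem by auto
  qed auto
  then have "card (I w) = card (I (w \<circ> t) - {(i, Suc i)})"
    by (rule bij_betw_same_card)
  moreover have "(i, Suc i) \<in> I (w \<circ> t)"
    using i asc by (auto simp: I)
  ultimately have "card (I (w \<circ> t)) = Suc (card (I w))"
    using fin by (metis card_Suc_Diff1)
  then show ?thesis
    unfolding perm_length_def t_def I_def by simp
qed

lemma perm_length_less_iff: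
  assumes w: "w permutes {1..n}" and i: "i \<in> {1..<n}"
  shows "perm_length n w < perm_length n (w \<circ> transpose i (Suc i)) \<longleftrightarrow> w i < w (Suc i)"
proof (cases "w i < w (Suc i)")
  case True
  then show ?thesis using perm_length_ascent[OF i True] by simp
next
  case False
  have "w i \<noteq> w (Suc i)"
    using inj_eq[OF permutes_inj[OF w], of i "Suc i"] by simp
  with False have "(w \<circ> transpose i (Suc i)) i < (w \<circ> transpose i (Suc i)) (Suc i)"
    by simp
  from perm_length_ascent[OF i this]
  have "perm_length n w = Suc (perm_length n (w \<circ> transpose i (Suc i)))"
    by (simp only: comp_transpose_twice)
  with False show ?thesis by simp
qed

lemma perm_length_le: "perm_length n w \<le> n * n"
proof -
  have "perm_length n w \<le> card ({1..n} \<times> {1..n})"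
    unfolding perm_length_def by (intro card_mono) auto
  then show ?thesis by simp
qed

text \<open>Going up along ascents terminates because the length is bounded; this is the induction behind all
  statements about permutations below.\<close>

lemma ascent_induct [consumes 1, case_names step]:
  assumes "w permutes {1..n}"
    and "\<And>w. w permutes {1..n} \<Longrightarrow>
      (\<And>i. i \<in> {1..<n} \<Longrightarrow> w i < w (Suc i) \<Longrightarrow> P (w \<circ> transpose i (Suc i))) \<Longrightarrow> P w"
  shows "P w"
  using assms(1)
proof (induction "n * n - perm_length n w" arbitrary: w rule: less_induct)
  case less
  show ?case
  proof (rule assms(2)[OF less.prems])
    fix i assume i: "i \<in> {1..<n}" "w i < w (Suc i)"
    show "P (w \<circ> transpose i (Suc i))"
    proof (rule less.hyps)
      show "w \<circ> transpose i (Suc i) permutes {1..n}"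
        by (rule permutes_comp_transpose[OF less.prems i(1)])
      show "n * n - perm_length n (w \<circ> transpose i (Suc i)) < n * n - perm_length n w"
        using perm_length_ascent[OF i] perm_length_le[of n "w \<circ> transpose i (Suc i)"] by linarith
    qed
  qed
qed

lemma longest_permI:
  assumes w: "w permutes {1..n}" and desc: "\<And>i. i \<in> {1..<n} \<Longrightarrow> \<not> w i < w (Suc i)"
  shows "w = longest_perm n"
proof
  fix k
  have step: "w (Suc i) < w i" if "i \<in> {1..<n}" for i
    using desc[OF that] permutes_inj[OF w] by (metis injD linorder_neqE_nat n_not_Suc_n)
  have range: "w i \<in> {1..n}" if "i \<in> {1..n}" for i
    using permutes_in_image[OF w] that by blast
  have upper: "i \<le> n \<longrightarrow> w i + i \<le> n + 1" if "1 \<le> i" for i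
    using that
  proof (induction i rule: dec_induct)
    case base
    then show ?case using range[of 1] by auto
  next
    case (step i)
    then show ?case using \<open>\<And>i. i \<in> {1..<n} \<Longrightarrow> w (Suc i) < w i\<close>[of i] by auto
  qed
  have lower: "1 \<le> i \<longrightarrow> n + 1 \<le> w i + i" if "i \<le> n" for i
    using that
  proof (induction i rule: inc_induct)
    case base
    then show ?case using range[of n] by auto
  next
    case (step i)
    then show ?case using \<open>\<And>i. i \<in> {1..<n} \<Longrightarrow> w (Suc i) < w i\<close>[of i] by auto
  qed
  show "w k = longest_perm n k"
  proof (cases "k \<in> {1..n}")
    case True
    then show ?thesis using upper[of k] lower[of k] by (auto simp: longest_perm_def)
  next
    case False
    then show ?thesis using permutes_not_in[OF w] by (simp only: longest_perm_def if_False)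
  qed
qed

lemma longest_perm_descent: "i \<in> {1..<n} \<Longrightarrow> \<not> longest_perm n i < longest_perm n (Suc i)"
  by (auto simp: longest_perm_def)

section \<open>Double Schubert polynomials\<close>

lemma is_double_schubert_cases:
  assumes "is_double_schubert n w f"
  obtains "w = longest_perm n"
      "f = (\<Prod>(i, j)\<in>{(i, j). 1 \<le> i \<and> 1 \<le> j \<and> i + j \<le> n}. xv i - yv (int j))"
  | i g where "i \<in> {1..<n}" "w i < w (Suc i)"
      "is_double_schubert n (w \<circ> transpose i (Suc i)) g" "f = divided_difference i g"
  using assms
proof (cases rule: is_double_schubert.cases)
  case longest
  then show ?thesis by (rule that(1))
next
  case (descend i g)
  then have "w i < w (Suc i)"
    using perm_length_less_iff[of w n i] by simp
  with descend show ?thesis by (intro that(2)[of i g]) simp_all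
qed

lemma is_double_schubert_descend:
  assumes "w permutes {1..n}" "i \<in> {1..<n}" "w i < w (Suc i)"
    "is_double_schubert n (w \<circ> transpose i (Suc i)) f"
  shows "is_double_schubert n w (divided_difference i f)"
  by (rule is_double_schubert.descend[OF assms(1,2) _ assms(4)])
     (simp only: perm_length_less_iff[OF assms(1,2)] assms(3))

lemma is_double_schubert_exists:
  assumes "w permutes {1..n}"
  shows "\<exists>f. is_double_schubert n w f"
  using assms
proof (induction rule: ascent_induct)
  case (step w)
  show ?case
  proof (cases "\<exists>i\<in>{1..<n}. w i < w (Suc i)")
    case True
    then obtain i where i: "i \<in> {1..<n}" "w i < w (Suc i)" by blast
    then obtain f where "is_double_schubert n (w \<circ> transpose i (Suc i)) f"
      using step.IH[OF i] by (elim exE)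
    then show ?thesis
      by (intro exI) (rule is_double_schubert_descend[OF step.hyps i])
  next
    case False
    then have "w = longest_perm n"
      by (intro longest_permI[OF step.hyps]) simp
    then show ?thesis
      by (simp only:) (rule exI, rule is_double_schubert.longest)
  qed
qed

text \<open>Two different ascents \<open>i < k\<close> can be continued to a common permutation: by the other ascent
  if they are far apart, and by the two sides of the braid relation if they are adjacent. The
  matching relation between divided differences shows that both descents give the same polynomial. Together
  with induction along ascents this replaces any discussion of reduced words.\<close>

lemma divided_difference_local_confluence:
  assumes w: "w permutes {1..n}"
    and unique: "\<And>i f g. i \<in> {1..<n} \<Longrightarrow> w i < w (Suc i) \<Longrightarrow>
      is_double_schubert n (w \<circ> transpose i (Suc i)) f \<Longrightarrow>
      is_double_schubert n (w \<circ> transpose i (Suc i)) g \<Longrightarrow> f = g"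
    and i: "i \<in> {1..<n}" "w i < w (Suc i)" "is_double_schubert n (w \<circ> transpose i (Suc i)) f"
    and k: "k \<in> {1..<n}" "w k < w (Suc k)" "is_double_schubert n (w \<circ> transpose k (Suc k)) g"
    and "i < k"
  shows "divided_difference i f = divided_difference k g"
proof -
  let ?s = "\<lambda>i. transpose i (Suc i)"
  note descend = is_double_schubert_descend
  note perm = permutes_comp_transpose
  have wi: "w \<circ> ?s i permutes {1..n}" and wk: "w \<circ> ?s k permutes {1..n}"
    by (rule perm[OF w i(1)], rule perm[OF w k(1)])
  show ?thesis
  proof (cases "k = Suc i")
    case False
    with \<open>i < k\<close> have ik: "Suc i < k" by simp
    let ?u = "w \<circ> ?s i \<circ> ?s k"
    have "?s k \<circ> ?s i = ?s i \<circ> ?s k"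
      using ik by (auto simp: fun_eq_iff transpose_def)
    then have eq: "w \<circ> ?s k \<circ> ?s i = ?u"
      by (simp only: comp_assoc)
    obtain h where h: "is_double_schubert n ?u h"
      using is_double_schubert_exists[OF perm[OF wi k(1)]] by (elim exE)
    have "is_double_schubert n (w \<circ> ?s i) (divided_difference k h)"
      using ik k(2) by (intro descend[OF wi k(1) _ h]) (simp add: transpose_def)
    then have "f = divided_difference k h"
      by (rule unique[OF i])
    moreover have "is_double_schubert n (w \<circ> ?s k) (divided_difference i h)"
      using ik i(2) by (intro descend[OF wk i(1)]) (simp_all add: transpose_def eq h)
    then have "g = divided_difference i h"
      by (rule unique[OF k])
    ultimately show ?thesis
      using divided_difference_commute[OF ik] by simp
  next
    case True
    let ?u = "w \<circ> ?s i \<circ> ?s k \<circ> ?s i"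
    have "?s k \<circ> (?s i \<circ> ?s k) = ?s i \<circ> (?s k \<circ> ?s i)"
      using True by (auto simp: fun_eq_iff transpose_def)
    then have eq: "w \<circ> ?s k \<circ> ?s i \<circ> ?s k = ?u"
      by (simp only: comp_assoc)
    obtain h where h: "is_double_schubert n ?u h"
      using is_double_schubert_exists[OF perm[OF perm[OF wi k(1)] i(1)]] by (elim exE)
    then have h': "is_double_schubert n (w \<circ> ?s k \<circ> ?s i \<circ> ?s k) h"
      by (simp only: eq)
    have "is_double_schubert n (w \<circ> ?s i) (divided_difference k (divided_difference i h))"
      using i(2) k(2) True
      by (intro descend[OF wi k(1) _ descend[OF perm[OF wi k(1)] i(1) _ h]]) (simp_all add: transpose_def)
    then have "f = divided_difference k (divided_difference i h)"
      by (rule unique[OF i])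
    moreover have "is_double_schubert n (w \<circ> ?s k) (divided_difference i (divided_difference k h))"
      using i(2) k(2) True
      by (intro descend[OF wk i(1) _ descend[OF perm[OF wk i(1)] k(1) _ h']]) (simp_all add: transpose_def)
    then have "g = divided_difference i (divided_difference k h)"
      by (rule unique[OF k])
    ultimately show ?thesis
      using True divided_difference_braid[of i h] by simp
  qed
qed

lemma is_double_schubert_unique:
  assumes "w permutes {1..n}" "is_double_schubert n w f" "is_double_schubert n w g"
  shows "f = g"
  using assms
proof (induction arbitrary: f g rule: ascent_induct)
  case (step w)
  from step.prems(1) show ?case
  proof (cases rule: is_double_schubert_cases)
    case 1
    from step.prems(2) show ?thesis
proof (cases rule: is_double_schubert_cases)
      case 1
      then show ?thesis using \<open>f = _\<close> by simp
    next
      case (2 i g')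
      then show ?thesis using \<open>w = _\<close> longest_perm_descent[of i n] by simp
    qed
  next
    case f: (2 i f')
    from step.prems(2) show ?thesis
    proof (cases rule: is_double_schubert_cases)
      case 1
      then show ?thesis using f(1,2) longest_perm_descent[of i n] by simp
    next
      case g: (2 k g')
      consider "i = k" | "i < k" | "k < i" by linarith
      then show ?thesis
      proof cases
        case 1
        have "f' = g'"
          by (rule step.IH[OF f(1-3)]) (simp only: 1 g(3))
        then show ?thesis by (simp only: f(4) g(4) 1)
      next
        case 2
        show ?thesis unfolding f(4) g(4)
          by (rule divided_difference_local_confluence[OF step.hyps _ f(1-3) g(1-3) 2]) (rule step.IH)
      next
        case 3
        show ?thesis unfolding f(4) g(4)
          by (rule divided_difference_local_confluence[OF step.hyps _ g(1-3) f(1-3) 3, symmetric])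
             (rule step.IH)
      qed
    qed
  qed
qed

lemma is_double_schubert_double_schubert:
  assumes "w permutes {1..n}"
  shows "is_double_schubert n w (double_schubert n w)"
proof -
  obtain f where f: "is_double_schubert n w f"
    using is_double_schubert_exists[OF assms] by (elim exE)
  show ?thesis
    unfolding double_schubert_def
    by (rule theI[of _ f]) (fact f, rule is_double_schubert_unique[OF assms _ f])
qed

lemma double_schubert_eqI:
  assumes "w permutes {1..n}" "is_double_schubert n w f"
  shows "double_schubert n w = f"
  by (rule is_double_schubert_unique[OF assms(1) is_double_schubert_double_schubert[OF assms(1)] assms(2)])

lemma double_schubert_ascent:
  assumes "w permutes {1..n}" "i \<in> {1..<n}" "w i < w (Suc i)"
  shows "double_schubert n w = divided_difference i (double_schubert n (w \<circ> transpose i (Suc i)))"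
  by (rule double_schubert_eqI[OF assms(1) is_double_schubert_descend[OF assms
        is_double_schubert_double_schubert[OF permutes_comp_transpose[OF assms(1,2)]]]])

section \<open>Columns of diagrams\<close>

text \<open>The empty column counts as the segment with \<open>m = 0\<close>, so the columns that vanish from the reduced
  diagram, or were empty from the start, are exactly these.\<close>

definition initial_segment :: "nat set \<Rightarrow> bool" where
  "initial_segment C \<longleftrightarrow> (\<exists>m. C = {1..m})"

definition box_prod :: "diagram \<Rightarrow> xy_poly" where
  "box_prod S = (\<Prod>(a, c)\<in>S. xv a + yv (int c))"

lemma diagram_eqI: "(\<And>c. column D c = column D' c) \<Longrightarrow> D = D'"
  by (auto simp: column_def set_eq_iff)

lemma column_swap_rows: "column (swap_rows i E) c = transpose i (Suc i) ` column E c"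
  by (auto simp: column_def swap_rows_def image_iff Bex_def)

lemma column_filter: "column {(a, c) \<in> E. c \<notin> M} c = (if c \<in> M then {} else column E c)"
  by (auto simp: column_def)

lemma column_diff: "column (D - E) c = column D c - column E c"
  by (auto simp: column_def)

lemma column_empty [simp]: "column {} c = {}"
  by (simp add: column_def)

lemma diagram_nonempty_iff: "E \<noteq> {} \<longleftrightarrow> (\<exists>c. column E c \<noteq> {})"
  by (auto simp: column_def)

lemma column_reduced:
  assumes "D \<subseteq> {1..n} \<times> UNIV"
  shows "column (reduced_diagram n D) c = (if initial_segment (column D c) then {} else column D c)"
proof -
  have "(\<exists>i\<in>{1..n}. column D c = {1..i}) \<longleftrightarrow> initial_segment (column D c) \<and> column D c \<noteq> {}"
  proof
    assume "initial_segment (column D c) \<and> column D c \<noteq> {}"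
    then obtain m where m: "column D c = {1..m}" "1 \<le> m"
      by (auto simp: initial_segment_def)
    then have "m \<in> column D c" by simp
    with assms have "m \<le> n" by (auto simp: column_def)
    with m show "\<exists>i\<in>{1..n}. column D c = {1..i}" by auto
  qed (auto simp: initial_segment_def)
  moreover have "column (reduced_diagram n D) c =
      (if \<exists>i\<in>{1..n}. column D c = {1..i} then {} else column D c)"
    by (auto simp: reduced_diagram_def interval_columns_def column_def)
  ultimately show ?thesis by auto
qed

lemma column_interval_part:
  assumes "D \<subseteq> {1..n} \<times> UNIV"
  shows "column (D - reduced_diagram n D) c = (if initial_segment (column D c) then column D c else {})"
  by (simp add: column_diff column_reduced[OF assms])

lemma prod_omega_interval_columns:
  assumes "finite D"
  shows "(\<Prod>i\<in>{1..n}. omega i (interval_columns D i)) = box_prod (D - reduced_diagram n D)"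
proof -
  have fin: "finite (interval_columns D i)" if "1 \<le> i" for i
  proof (rule finite_subset)
    show "interval_columns D i \<subseteq> snd ` D"
      using that by (force simp: interval_columns_def column_def)
  qed (use assms in simp)
  have "omega i (interval_columns D i) = box_prod ({1..i} \<times> interval_columns D i)" for i
    by (simp add: omega_def box_prod_def prod.cartesian_product)
  moreover have "(\<Prod>i\<in>{1..n}. box_prod ({1..i} \<times> interval_columns D i)) =
      box_prod (\<Union>i\<in>{1..n}. {1..i} \<times> interval_columns D i)"
    unfolding box_prod_def
    by (rule prod.UNION_disjoint[symmetric]) (auto simp: fin, auto simp: interval_columns_def)
  moreover have "(\<Union>i\<in>{1..n}. {1..i} \<times> interval_columns D i) = D - reduced_diagram n D"
    by (auto simp: reduced_diagram_def interval_columns_def column_def set_eq_iff)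
  ultimately show ?thesis by simp
qed

text \<open>Nonvanishing allows the interval factors to be cancelled when symmetry is transferred from a Schubert
  polynomial to the orthodontic factor.\<close>

lemma box_prod_nonzero: "box_prod S \<noteq> 0"
proof (cases "finite S")
  case True
  have "xv a + yv c \<noteq> 0" for a c
  proof
    assume "xv a + yv c = 0"
    then have "subst (\<lambda>v. if v = X a then 1 else 0) (xv a + yv c) = 0"
      by (simp add: subst_0)
    then show False by (simp add: subst_ring_simps)
  qed
  with True show ?thesis by (auto simp: box_prod_def)
qed (simp add: box_prod_def)

lemma image_transpose_atLeastAtMost:
  assumes "m \<noteq> i" "1 \<le> i"
  shows "transpose i (Suc i) ` {1..m} = {1..m}"
  by (rule transpose_image_eq) (use assms in auto)

section \<open>Rothe diagrams along an ascent at a left-to-right minimum\<close>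

lemma mem_column_rothe:
  "a \<in> column (rothe_diagram n w) c \<longleftrightarrow> a \<in> {1..n} \<and> c \<in> {1..n} \<and> a < inv w c \<and> c < w a"
  by (simp add: column_def rothe_diagram_def)

lemma rothe_subset: "rothe_diagram n w \<subseteq> {1..n} \<times> {1..n}"
  by (auto simp: rothe_diagram_def)

lemma rothe_finite: "finite (rothe_diagram n w)"
  by (rule finite_subset[OF rothe_subset]) simp

abbreviation reduced_rothe :: "nat \<Rightarrow> (nat \<Rightarrow> nat) \<Rightarrow> diagram" where
  "reduced_rothe n w \<equiv> reduced_diagram n (rothe_diagram n w)"

abbreviation rothe_intervals :: "nat \<Rightarrow> (nat \<Rightarrow> nat) \<Rightarrow> diagram" where
  "rothe_intervals n w \<equiv> rothe_diagram n w - reduced_diagram n (rothe_diagram n w)"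

lemma column_reduced_rothe:
  "column (reduced_rothe n w) c =
    (if initial_segment (column (rothe_diagram n w) c) then {} else column (rothe_diagram n w) c)"
  by (rule column_reduced) (use rothe_subset in blast)

lemma column_rothe_intervals:
  "column (rothe_intervals n w) c =
    (if initial_segment (column (rothe_diagram n w) c) then column (rothe_diagram n w) c else {})"
  by (rule column_interval_part) (use rothe_subset in blast)

text \<open>The position \<open>i\<close> carries a left-to-right minimum if and only if column \<open>w i\<close> of the Rothe diagram is
  the interval \<open>[i - 1]\<close>. Only then does the box gained by going up from \<open>w\<close> to \<open>w s\<^sub>i\<close> land at the foot of an
  interval column and produce another interval column.\<close>

locale ascent_at_minimum =
  fixes n :: nat and w :: "nat \<Rightarrow> nat" and i :: nat
  assumes perm: "w permutes {1..n}"
    and index: "i \<in> {1..<n}"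
    and ascent: "w i < w (Suc i)"
    and minimum: "\<And>p. p \<in> {1..<i} \<Longrightarrow> w i < w p"
begin

abbreviation t :: "nat \<Rightarrow> nat" where "t \<equiv> transpose i (Suc i)"
abbreviation v :: "nat \<Rightarrow> nat" where "v \<equiv> w \<circ> t"

lemma perm_v: "v permutes {1..n}"
  by (rule permutes_comp_transpose[OF perm index])

lemma inv_v: "inv v c = t (inv w c)"
  using permutes_bij[OF perm] by (simp add: o_inv_distrib)

lemma w_eq_iff: "w a = w b \<longleftrightarrow> a = b"
  by (rule inj_eq[OF permutes_inj[OF perm]])

lemma w_inv: "w (inv w c) = c"
  by (rule permutes_inverses(1)[OF perm])

lemma inv_w: "inv w (w a) = a"
  by (rule permutes_inverses(2)[OF perm])

lemma w_range: "w a \<in> {1..n} \<longleftrightarrow> a \<in> {1..n}"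
  by (rule permutes_in_image[OF perm])

lemma column_min: "column (rothe_diagram n w) (w i) = {1..<i}"
  using index minimum by (auto simp: mem_column_rothe inv_w w_range[of i, simplified])

lemma t_cases: 
  obtains "a = i" "t a = Suc i" | "a = Suc i" "t a = i" | "a \<noteq> i" "a \<noteq> Suc i" "t a = a"
  by (metis transpose_apply_first transpose_apply_second transpose_apply_other)

lemma mem_column_v:
  "a \<in> column (rothe_diagram n v) c \<longleftrightarrow> t a \<in> column (rothe_diagram n w) c \<or> a = i \<and> c = w i"
proof -
  define p where "p = inv w c"
  have c: "c = w p" by (simp add: p_def w_inv)
  have mem: "w p \<in> {1..n} \<longleftrightarrow> p \<in> {1..n}" by (rule w_range)
  have "(a \<in> {1..n} \<and> w p \<in> {1..n} \<and> a < t p \<and> w p < w (t a)) \<longleftrightarrow>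
      (t a \<in> {1..n} \<and> w p \<in> {1..n} \<and> t a < p \<and> w p < w (t a)) \<or> a = i \<and> p = i"
    unfolding mem
    by (rule t_cases[of a]; rule t_cases[of p]) (use index ascent in auto)
  then show ?thesis
    by (simp add: mem_column_rothe inv_v c inv_w w_eq_iff del: transpose_apply_first)
qed

lemma column_v:
  "column (rothe_diagram n v) c = (if c = w i then {1..i} else t ` column (rothe_diagram n w) c)"
proof (cases "c = w i")
  case True
  show ?thesis unfolding set_eq_iff True mem_column_v column_min
  proof
    fix a
    show "t a \<in> {1..<i} \<or> a = i \<and> w i = w i \<longleftrightarrow> a \<in> (if w i = w i then {1..i} else t ` {1..<i})"
      by (rule t_cases[of a]) (use index in auto)
  qed
next
  case False
  then show ?thesis
    unfolding set_eq_iff mem_column_v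
    by (auto simp: image_iff) (metis transpose_involutory)+
qed

text \<open>A column that ends exactly in row \<open>i\<close> belongs to a value below \<open>w i\<close> which is either at position \<open>i + 1\<close> or
  at least \<open>w (i + 1)\<close>; the ascent excludes both. Consequently all interval columns of \<open>w\<close> survive the
  swap of rows \<open>i\<close> and \<open>i + 1\<close> unchanged.\<close>

lemma column_neq_index: "column (rothe_diagram n w) c \<noteq> {1..i}"
proof
  assume eq: "column (rothe_diagram n w) c = {1..i}"
  then have "i \<in> column (rothe_diagram n w) c" using index by simp
  then have "c < w i" "i < inv w c" "c \<in> {1..n}" by (auto simp: mem_column_rothe)
  moreover have "Suc i \<notin> column (rothe_diagram n w) c" by (simp add: eq)
  ultimately have "inv w c = Suc i"
    using index ascent by (auto simp: mem_column_rothe)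
  then have "c = w (Suc i)" using w_inv[of c] by simp
  with \<open>c < w i\<close> ascent show False by simp
qed

lemma initial_segment_v:
  assumes "c \<noteq> w i"
  shows "initial_segment (column (rothe_diagram n v) c) \<longleftrightarrow>
    initial_segment (column (rothe_diagram n w) c) \<or> column (rothe_diagram n v) c = {1..i}"
proof
  have col: "column (rothe_diagram n v) c = t ` column (rothe_diagram n w) c"
    using assms by (simp add: column_v)
  have "1 \<le> i" using index by simp
  {
    assume "initial_segment (column (rothe_diagram n v) c)"
    then obtain m where m: "column (rothe_diagram n v) c = {1..m}" by (auto simp: initial_segment_def)
    have "column (rothe_diagram n w) c = t ` {1..m}"
      unfolding m[symmetric] col by (simp add: image_image)
    with m show "initial_segment (column (rothe_diagram n w) c) \<or> column (rothe_diagram n v) c = {1..i}"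
      using image_transpose_atLeastAtMost[OF _ \<open>1 \<le> i\<close>, of m] by (auto simp: initial_segment_def)
  }
  {
    assume "initial_segment (column (rothe_diagram n w) c) \<or> column (rothe_diagram n v) c = {1..i}"
    then show "initial_segment (column (rothe_diagram n v) c)"
    proof
      assume "initial_segment (column (rothe_diagram n w) c)"
      then obtain m where m: "column (rothe_diagram n w) c = {1..m}" by (auto simp: initial_segment_def)
      then have "m \<noteq> i" using column_neq_index by metis
      then show ?thesis
        unfolding col m using image_transpose_atLeastAtMost[OF _ \<open>1 \<le> i\<close>, of m]
        by (auto simp: initial_segment_def)
    qed (auto simp: initial_segment_def)
  }
qed

text \<open>These are the columns removed by an orthodontic step at tooth \<open>i\<close>. The column \<open>w i\<close>, which also becomes
  \<open>[i]\<close>, is not among them: it is empty in the reduced diagram.\<close>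

definition M :: "nat set" where
  "M = {c. column (swap_rows i (reduced_rothe n w)) c = {1..i}}"

lemma initial_segment_min: "initial_segment (column (rothe_diagram n w) (w i))"
  unfolding column_min initial_segment_def using index
  by (intro exI[of _ "i - 1"]) auto

lemma M_iff: "c \<in> M \<longleftrightarrow> c \<noteq> w i \<and> column (rothe_diagram n v) c = {1..i}"
proof (cases "initial_segment (column (rothe_diagram n w) c)")
  case True
  then have "c \<notin> M"
    using index by (auto simp: M_def column_swap_rows column_reduced_rothe)
  moreover have "c = w i \<or> column (rothe_diagram n v) c \<noteq> {1..i}"
  proof -
    from True obtain m where m: "column (rothe_diagram n w) c = {1..m}" by (auto simp: initial_segment_def)
    then have "m \<noteq> i" using column_neq_index by metis
    with index have "t ` {1..m} \<noteq> {1..i}"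
      by (subst image_transpose_atLeastAtMost) auto
    then show ?thesis by (simp add: column_v m)
  qed
  ultimately show ?thesis by auto
next
  case False
  then have "c \<noteq> w i" using initial_segment_min by metis
  with False show ?thesis by (simp add: M_def column_swap_rows column_reduced_rothe column_v)
qed

lemma finite_M: "finite M"
proof (rule finite_subset)
  show "M \<subseteq> {1..n}"
  proof
    fix c assume "c \<in> M"
    then have "i \<in> column (rothe_diagram n v) c" using index by (simp add: M_iff)
    then show "c \<in> {1..n}" by (simp add: mem_column_rothe)
  qed
qed simp

lemma reduced_rothe_v:
  "reduced_rothe n v = {(a, c) \<in> swap_rows i (reduced_rothe n w). c \<notin> M}"
proof (rule diagram_eqI)
  fix c
  show "column (reduced_rothe n v) c = column {(a, c) \<in> swap_rows i (reduced_rothe n w). c \<notin> M} c"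
  proof (cases "c = w i")
    case True
    have "initial_segment {1..i}" by (auto simp: initial_segment_def)
    with True show ?thesis
      using initial_segment_min
      unfolding column_filter column_swap_rows column_reduced_rothe
      by (simp add: column_v)
  next
    case False
    then show ?thesis
      unfolding column_filter
      unfolding column_swap_rows column_reduced_rothe initial_segment_v[OF False] M_iff
      by (simp add: column_v)
  qed
qed

lemma column_rothe_intervals_v:
  "column (rothe_intervals n v) c =
    (if c = w i \<or> c \<in> M then {1..i} else column (rothe_intervals n w) c)"
proof (cases "c = w i")
  case True
  have "initial_segment {1..i}" by (auto simp: initial_segment_def)
  with True show ?thesis by (simp add: column_rothe_intervals column_v)
next
  case False
  have *: "t ` column (rothe_diagram n w) c = column (rothe_diagram n w) c"
    if "initial_segment (column (rothe_diagram n w) c)"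
  proof -
    from that obtain m where m: "column (rothe_diagram n w) c = {1..m}" by (auto simp: initial_segment_def)
    then have "m \<noteq> i" using column_neq_index by metis
    then show ?thesis unfolding m using index by (intro image_transpose_atLeastAtMost) auto
  qed
  show ?thesis
  proof (cases "c \<in> M")
    case True
    have "initial_segment {1..i}" by (auto simp: initial_segment_def)
    with True False show ?thesis by (simp add: column_rothe_intervals M_iff)
  next
    case notM: False
    with False show ?thesis
      using * by (auto simp: column_rothe_intervals initial_segment_v M_iff) (auto simp: column_v)
  qed
qed

lemma rothe_intervals_v:
  "rothe_intervals n v = rothe_intervals n w \<union> ({(i, w i)} \<union> {1..i} \<times> M)" (is "_ = ?R")
  and rothe_intervals_disjoint: "rothe_intervals n w \<inter> ({(i, w i)} \<union> {1..i} \<times> M) = {}"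
proof -
  have colM: "column (rothe_intervals n w) c = {}" if "c \<in> M" for c
  proof -
    have "i \<in> column (swap_rows i (reduced_rothe n w)) c"
      using that index by (simp add: M_def)
    then show ?thesis by (auto simp: column_swap_rows column_reduced_rothe column_rothe_intervals split: if_splits)
  qed
  have colmin: "column (rothe_intervals n w) (w i) = {1..<i}"
    using initial_segment_min by (simp add: column_rothe_intervals column_min)
  have "w i \<notin> M" by (simp add: M_iff)
  show "rothe_intervals n v = ?R"
  proof (rule diagram_eqI)
    fix c
    have "column ?R c = column (rothe_intervals n w) c \<union>
        ((if c = w i then {i} else {}) \<union> (if c \<in> M then {1..i} else {}))"
      by (auto simp: column_def)
    then show "column (rothe_intervals n v) c = column ?R c"
      using colM colmin \<open>w i \<notin> M\<close> index by (auto simp: column_rothe_intervals_v)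
  qed
  have "i \<notin> column (rothe_intervals n w) (w i)" by (simp add: colmin)
  moreover have "a \<notin> column (rothe_intervals n w) c" if "c \<in> M" for a c using colM that by simp
  ultimately show "rothe_intervals n w \<inter> ({(i, w i)} \<union> {1..i} \<times> M) = {}"
    by (auto simp: column_def)
qed

lemma box_prod_v:
  "box_prod (rothe_intervals n v) =
    box_prod (rothe_intervals n w) * ((xv i + yv (int (w i))) * omega i M)"
proof -
  have "w i \<notin> M" by (simp add: M_iff)
  then have "box_prod ({(i, w i)} \<union> {1..i} \<times> M) = (xv i + yv (int (w i))) * omega i M"
    unfolding box_prod_def omega_def prod.cartesian_product
    by (subst prod.union_disjoint) (auto simp: finite_M)
  moreover have "box_prod (rothe_intervals n v) =
      box_prod (rothe_intervals n w) * box_prod ({(i, w i)} \<union> {1..i} \<times> M)"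
    unfolding rothe_intervals_v unfolding box_prod_def
    by (rule prod.union_disjoint) (use rothe_finite finite_M rothe_intervals_disjoint in auto)
  ultimately show ?thesis by simp
qed

lemma swap_x_box_prod: "swap_x i (box_prod (rothe_intervals n w)) = box_prod (rothe_intervals n w)"
proof -
  have "swap_rows i (rothe_intervals n w) = rothe_intervals n w"
  proof (rule diagram_eqI)
    fix c
    have "t ` {1..m} = {1..m}" if "column (rothe_diagram n w) c = {1..m}" for m
    proof (rule image_transpose_atLeastAtMost)
      show "m \<noteq> i" using that column_neq_index by metis
    qed (use index in simp)
    then show "column (swap_rows i (rothe_intervals n w)) c = column (rothe_intervals n w) c"
      by (auto simp: column_swap_rows column_rothe_intervals initial_segment_def)
  qed
  then have "bij_betw (map_prod t id) (rothe_intervals n w) (rothe_intervals n w)"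
    unfolding swap_rows_def bij_betw_def
    by (auto intro!: inj_on_subset[OF prod.inj_map])
  then have "(\<Prod>b\<in>rothe_intervals n w. case map_prod t id b of (a, c) \<Rightarrow> xv a + yv (int c)) =
      box_prod (rothe_intervals n w)"
    unfolding box_prod_def by (rule prod.reindex_bij_betw)
  then show ?thesis
    by (simp add: box_prod_def swap_x_ring_simps split_beta map_prod_def)
qed

end

text \<open>If the two entries of the ascent do not start an occurrence of the pattern 132, then every
  column contains either both rows \<open>i\<close> and \<open>i + 1\<close> or neither, apart from the box about to be
  added. In this case the reduced diagram does not notice the swap.\<close>

locale ascent_without_132 = ascent_at_minimum +
  assumes no_132: "\<And>c. w i < c \<Longrightarrow> c < w (Suc i) \<Longrightarrow> \<not> Suc i < inv w c"
begin

lemma index_mem_column_iff: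
  "i \<in> column (rothe_diagram n w) c \<longleftrightarrow> Suc i \<in> column (rothe_diagram n w) c"
proof -
  have "inv w c \<noteq> Suc i" if "c < w i"
    using that ascent w_inv[of c] by auto
  moreover have "c \<noteq> w i" if "Suc i < inv w c"
    using that inv_w[of i] by auto
  ultimately have "i < inv w c \<and> c < w i \<longleftrightarrow> Suc i < inv w c \<and> c < w (Suc i)"
    using ascent no_132[of c] by linarith
  then show ?thesis
    using index by (simp add: mem_column_rothe)
qed

lemma t_image_column: "t ` column (reduced_rothe n w) c = column (reduced_rothe n w) c"
  using index_mem_column_iff by (intro transpose_image_eq) (simp add: column_reduced_rothe)

lemma M_empty: "M = {}"
proof -
  have "column (reduced_rothe n w) c \<noteq> {1..i}" for c
    using column_neq_index index by (auto simp: column_reduced_rothe)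
  then show ?thesis by (simp add: M_def column_swap_rows t_image_column)
qed

lemma reduced_rothe_v_eq: "reduced_rothe n v = reduced_rothe n w"
  by (rule diagram_eqI) (simp add: reduced_rothe_v M_empty column_swap_rows t_image_column)

end

section \<open>The first missing tooth of a reduced Rothe diagram\<close>

definition first_tooth :: "nat \<Rightarrow> diagram \<Rightarrow> nat \<Rightarrow> nat \<Rightarrow> bool" where
  "first_tooth n E j i \<longleftrightarrow> E \<noteq> {} \<and> j = (LEAST j. column E j \<noteq> {}) \<and>
     missing_teeth n (column E j) \<noteq> {} \<and> i = Min (missing_teeth n (column E j))"

lemma finite_missing_teeth: "finite (missing_teeth n C)"
  by (simp add: missing_teeth_def)

lemma first_tooth_iff:
  "first_tooth n E j i \<longleftrightarrow> column E j \<noteq> {} \<and> (\<forall>c<j. column E c = {}) \<and>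
     i \<in> missing_teeth n (column E j) \<and> (\<forall>b\<in>missing_teeth n (column E j). i \<le> b)"
proof -
  have least: "E \<noteq> {} \<and> j = (LEAST j. column E j \<noteq> {}) \<longleftrightarrow> column E j \<noteq> {} \<and> (\<forall>c<j. column E c = {})"
  proof
    assume *: "E \<noteq> {} \<and> j = (LEAST j. column E j \<noteq> {})"
    then obtain c where "column E c \<noteq> {}" by (auto simp: diagram_nonempty_iff)
    then show "column E j \<noteq> {} \<and> (\<forall>c<j. column E c = {})"
      using * LeastI[of "\<lambda>j. column E j \<noteq> {}"] not_less_Least[of _ "\<lambda>j. column E j \<noteq> {}"] by blast
  next
    assume *: "column E j \<noteq> {} \<and> (\<forall>c<j. column E c = {})"
    then have "(LEAST j. column E j \<noteq> {}) = j"
      by (intro Least_equality) (auto simp: not_less[symmetric])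
    with * show "E \<noteq> {} \<and> j = (LEAST j. column E j \<noteq> {})"
      by (auto simp: diagram_nonempty_iff)
  qed
  have min: "C \<noteq> {} \<and> i = Min C \<longleftrightarrow> i \<in> C \<and> (\<forall>b\<in>C. i \<le> b)" if "finite C" for C :: "nat set"
    using that by (metis Min_eqI Min_in Min_le empty_iff)
  show ?thesis
    unfolding first_tooth_def using least min[OF finite_missing_teeth] by blast
qed

lemma orthodontic_sequence_first_tooth:
  assumes "first_tooth n E j i" "M = {c. column (swap_rows i E) c = {1..i}}"
    "orthodontic_sequence n {(a, c) \<in> swap_rows i E. c \<notin> M} ss"
  shows "orthodontic_sequence n E
    ((i, int j - int (card {a \<in> {1..i}. a \<notin> column E j}), M) # ss)"
  by (rule orthodontic_sequence.step[OF _ _ _ _ refl refl assms(2,3)])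
     (use assms(1) in \<open>auto simp: first_tooth_def\<close>)

text \<open>This is why orthodontia never gets stuck on a column that is not an interval.\<close>

lemma initial_segment_if_no_missing_tooth:
  assumes "C \<subseteq> {1..n}" "missing_teeth n C = {}"
  shows "initial_segment C"
proof (cases "C = {}")
  case True
  then show ?thesis by (auto simp: initial_segment_def intro: exI[of _ 0])
next
  case False
  have fin: "finite C" by (rule finite_subset[OF assms(1)]) simp
  have "a \<in> C" if "1 \<le> a" "a \<le> Max C" for a
    using that(2,1)
  proof (induction a rule: inc_induct)
    case base
    then show ?case using fin False by simp
  next
    case (step a)
    then have "Suc a \<in> C" by simp
    then have "Suc a \<le> n" using assms(1) by auto
    moreover have "a \<notin> missing_teeth n C" using assms(2) by simp
    ultimately show ?case
      using \<open>Suc a \<in> C\<close> step.prems by (simp add: missing_teeth_def)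
  qed
  with fin assms(1) have "C = {1..Max C}" by auto
  then show ?thesis by (auto simp: initial_segment_def)
qed

lemma first_tooth_exists:
  assumes "reduced_rothe n w \<noteq> {}"
  obtains j i where "first_tooth n (reduced_rothe n w) j i"
proof -
  let ?E = "reduced_rothe n w"
  define j where "j = (LEAST j. column ?E j \<noteq> {})"
  from assms have j: "column ?E j \<noteq> {}"
    unfolding j_def diagram_nonempty_iff by (rule LeastI_ex)
  then have col: "column ?E j = column (rothe_diagram n w) j"
      and notin: "\<not> initial_segment (column (rothe_diagram n w) j)"
    by (auto simp: column_reduced_rothe split: if_splits)
  have "column (rothe_diagram n w) j \<subseteq> {1..n}"
    by (auto simp: mem_column_rothe)
  then have "missing_teeth n (column ?E j) \<noteq> {}"
    using initial_segment_if_no_missing_tooth notin unfolding col by blast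
  with assms show thesis
    by (intro that[of j]) (simp add: first_tooth_def j_def)
qed

text \<open>A value \<open>c\<close> between \<open>w a\<close> and \<open>w (a + 1)\<close> that occurs later would give column \<open>c\<close> a missing tooth at \<open>a\<close>, but
  its column is an interval.\<close>

lemma no_132_if_columns_empty:
  assumes perm: "w permutes {1..n}"
    and empty: "column (reduced_rothe n w) c = {}"
    and a: "a \<in> {1..<n}" "w a < c" "c < w (Suc a)"
  shows "\<not> Suc a < inv w c"
proof
  assume less: "Suc a < inv w c"
  obtain m where m: "column (rothe_diagram n w) c = {1..m}"
    using empty by (auto simp: column_reduced_rothe initial_segment_def split: if_splits)
  have "w (Suc a) \<in> {1..n}"
    by (rule iffD2[OF permutes_in_image[OF perm]]) (use a in simp)
  with a have "c \<in> {1..n}" by auto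
  with less a have "Suc a \<in> column (rothe_diagram n w) c"
    by (simp add: mem_column_rothe)
  then have "a \<in> column (rothe_diagram n w) c" using m a by simp
  then show False using a by (simp add: mem_column_rothe)
qed

lemma minimum_if_decreasing:
  fixes w :: "nat \<Rightarrow> nat"
  assumes dec: "\<And>q. 1 \<le> q \<Longrightarrow> q < a \<Longrightarrow> w q < j \<Longrightarrow> w (Suc q) < w q"
    and a: "w a < j" and p: "p \<in> {1..<a}"
  shows "w a < w p"
proof (cases "w p < j")
  case True
  have "p < b \<longrightarrow> w b < w p" if "p \<le> b" "b \<le> a" for b
    using that
  proof (induction b rule: dec_induct)
    case (step b)
    then have "w b \<le> w p" by (cases "b = p") auto
    moreover from this True have "w (Suc b) < w b" using dec[of b] step p by simp
    ultimately show ?case by simp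
  qed simp
  then show ?thesis using p by simp
next
  case False
  with a show ?thesis by simp
qed

text \<open>The bound \<open>j\<close> will be the leftmost column of the reduced diagram and \<open>k\<close> its first missing tooth; for an
  empty reduced diagram \<open>j = n + 1\<close> and \<open>k = n\<close> are used. Before the first ascent among the small values the
  permutation decreases on them, which makes the ascent start at a left-to-right minimum.\<close>

lemma first_ascent_without_132:
  assumes perm: "w permutes {1..n}"
    and empty: "\<And>c. c < j \<Longrightarrow> column (reduced_rothe n w) c = {}"
    and upward: "\<And>a. 1 \<le> a \<Longrightarrow> a < k \<Longrightarrow> w a < j \<Longrightarrow> w (Suc a) < j"
    and k: "k \<le> n"
    and ascent: "b \<in> {1..<k}" "w b < j" "w b < w (Suc b)"
  obtains a where "a \<in> {1..<k}" "w a < j" "ascent_without_132 n w a"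
proof -
  let ?P = "\<lambda>a. 1 \<le> a \<and> a < k \<and> w a < j \<and> w a < w (Suc a)"
  define a where "a = (LEAST a. ?P a)"
  have "?P b" using ascent by simp
  then have a: "?P a" unfolding a_def by (rule LeastI)
  have dec: "w (Suc q) < w q" if "1 \<le> q" "q < a" "w q < j" for q
  proof -
    have "\<not> ?P q" using not_less_Least[of q ?P] that(2) unfolding a_def[symmetric] by simp
    moreover have "w q \<noteq> w (Suc q)" using inj_eq[OF permutes_inj[OF perm], of q "Suc q"] by simp
    ultimately show ?thesis using that a by simp
  qed
  have "ascent_without_132 n w a"
  proof
    show a_range: "a \<in> {1..<n}" using a k by simp
    show "w a < w (Suc a)" using a by simp
    show "w a < w p" if "p \<in> {1..<a}" for p
      by (rule minimum_if_decreasing[of a w j, OF dec _ that]) (use a in auto)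
    show "\<not> Suc a < inv w c" if "w a < c" "c < w (Suc a)" for c
      using no_132_if_columns_empty[OF perm empty a_range that] upward[of a] that a by simp
  qed (fact perm)
  with a show thesis by (intro that) auto
qed

lemma empty_reduced_ascent:
  assumes perm: "w permutes {1..n}" and empty: "reduced_rothe n w = {}" and "w \<noteq> longest_perm n"
  obtains a where "ascent_without_132 n w a"
proof -
  obtain b where b: "b \<in> {1..<n}" "w b < w (Suc b)"
    using assms(3) longest_permI[OF perm] by metis
  have range: "w a < Suc n" if "a \<in> {1..n}" for a
  proof -
    have "w a \<in> {1..n}" by (rule iffD2[OF permutes_in_image[OF perm] that])
    then show ?thesis by simp
  qed
  show thesis
  proof (rule first_ascent_without_132[OF perm _ _ order_refl b(1) _ b(2)])
    show "column (reduced_rothe n w) c = {}" if "c < Suc n" for c by (simp add: empty)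
    show "w (Suc a) < Suc n" if "1 \<le> a" "a < n" for a using range[of "Suc a"] that by simp
    show "w b < Suc n" using range[of b] b by simp
  qed (rule that)
qed

text \<open>The rows \<open>a \<le> i\<close> with \<open>w a < j\<close> are those missing from column \<open>j\<close>; they form the gap above the tooth in
  row \<open>i + 1\<close>.\<close>

locale rothe_tooth =
  fixes n :: nat and w :: "nat \<Rightarrow> nat" and j i :: nat
  assumes perm: "w permutes {1..n}"
    and tooth: "first_tooth n (reduced_rothe n w) j i"
begin

abbreviation E :: diagram where "E \<equiv> reduced_rothe n w"

lemma index: "i \<in> {1..<n}"
  using tooth by (simp add: first_tooth_iff missing_teeth_def)

lemma column_j: "column E j = column (rothe_diagram n w) j"
  using tooth by (auto simp: first_tooth_iff column_reduced_rothe split: if_splits)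

lemma w_neq: "a \<noteq> b \<Longrightarrow> w a \<noteq> w b"
  using inj_eq[OF permutes_inj[OF perm]] by simp

lemma w_inv: "w (inv w c) = c"
  by (rule permutes_inverses(1)[OF perm])

lemma w_range: "a \<in> {1..n} \<Longrightarrow> w a \<in> {1..n}"
  using permutes_in_image[OF perm] by simp

lemma tooth_row: "j < w (Suc i)" "Suc i < inv w j" "j \<in> {1..n}"
  and gap_row: "w i < j"
proof -
  have "Suc i \<in> column E j" "i \<notin> column E j"
    using tooth by (simp_all add: first_tooth_iff missing_teeth_def)
  then show *: "j < w (Suc i)" "Suc i < inv w j" "j \<in> {1..n}"
    by (simp_all add: column_j mem_column_rothe)
  have "w i \<le> j"
    using \<open>i \<notin> column E j\<close> index * by (auto simp: column_j mem_column_rothe)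
  moreover have "w i \<noteq> j"
    using *(2) permutes_inverses(2)[OF perm, of i] by auto
  ultimately show "w i < j" by simp
qed

lemma mem_column_j:
  assumes "1 \<le> a" "a \<le> i"
  shows "a \<in> column E j \<longleftrightarrow> j < w a" and "w a \<noteq> j"
proof -
  show "a \<in> column E j \<longleftrightarrow> j < w a"
    using assms index tooth_row by (simp add: column_j mem_column_rothe)
  show "w a \<noteq> j"
    using assms tooth_row(2) permutes_inverses(2)[OF perm, of a] by auto
qed

lemma gap_upward:
  assumes "1 \<le> a" "a < i" "w a < j"
  shows "w (Suc a) < j"
proof (rule ccontr)
  assume "\<not> w (Suc a) < j"
  then have "j < w (Suc a)" using mem_column_j(2)[of "Suc a"] assms by simp
  then have "a \<in> missing_teeth n (column E j)"
    using assms index mem_column_j(1)[of a] mem_column_j(1)[of "Suc a"] by (simp add: missing_teeth_def)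
  then have "i \<le> a" using tooth by (simp add: first_tooth_iff)
  with assms show False by simp
qed

definition decreasing :: bool where
  "decreasing \<longleftrightarrow> (\<forall>a. 1 \<le> a \<longrightarrow> a < i \<longrightarrow> w a < j \<longrightarrow> w (Suc a) < w a)"

lemma decreasing_ascent_at_minimum:
  assumes decreasing
  shows "ascent_at_minimum n w i"
proof
  show "w i < w (Suc i)" using gap_row tooth_row by simp
  show "w i < w p" if "p \<in> {1..<i}" for p
    by (rule minimum_if_decreasing[of i w j, OF _ gap_row that]) (use assms in \<open>auto simp: decreasing_def\<close>)
qed (fact perm index)+

lemma not_decreasing:
  assumes "\<not> decreasing"
  obtains a where "a \<in> {1..<i}" "w a < j" "ascent_without_132 n w a"
proof -
  obtain b where b: "1 \<le> b" "b < i" "w b < j" "\<not> w (Suc b) < w b"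
    using assms by (auto simp: decreasing_def)
  show thesis
  proof (rule first_ascent_without_132[OF perm _ gap_upward _ _ b(3) _ that])
    show "column E c = {}" if "c < j" for c using that tooth by (simp add: first_tooth_iff)
    show "i \<le> n" "b \<in> {1..<i}" using index b by auto
    show "w b < w (Suc b)" using b w_neq[of b "Suc b"] by simp
  qed
qed

text \<open>Every value between \<open>w i\<close> and \<open>j\<close> sits in the gap, for otherwise its column would be a non-interval to the
  left of \<open>j\<close>; conversely all values in the gap are at least the left-to-right minimum \<open>w i\<close>. So the gap has
  \<open>j - w i\<close> rows, and the second index of the orthodontic operator is \<open>w i\<close>.\<close>

lemma card_gap:
  assumes "ascent_at_minimum n w i"
  shows "int j - int (card {a \<in> {1..i}. a \<notin> column E j}) = int (w i)"
proof -
  interpret ascent_at_minimum n w i by fact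
  have "{a \<in> {1..i}. a \<notin> column E j} = {a \<in> {1..i}. w a < j}"
  proof (rule Collect_cong)
    show "a \<in> {1..i} \<and> a \<notin> column E j \<longleftrightarrow> a \<in> {1..i} \<and> w a < j" for a
      using mem_column_j[of a] by (cases "a \<in> {1..i}") auto
  qed
  moreover have "w ` {a \<in> {1..i}. w a < j} = {w i..<j}"
  proof (intro equalityI subsetI)
    fix c assume "c \<in> w ` {a \<in> {1..i}. w a < j}"
    then obtain a where "c = w a" "1 \<le> a" "a \<le> i" "w a < j" by auto
    then show "c \<in> {w i..<j}" using minimum[of a] by (cases "a = i") auto
  next
    fix c assume c: "c \<in> {w i..<j}"
    have "inv w c \<le> i"
    proof (rule ccontr)
      assume *: "\<not> inv w c \<le> i"
      then have "c \<noteq> w i" using permutes_inverses(2)[OF perm, of i] by auto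
      moreover have "inv w c \<noteq> Suc i" using w_inv[of c] tooth_row(1) c by auto
      ultimately show False
        using * no_132_if_columns_empty[OF perm _ index, of c] c tooth_row(1) tooth by (simp add: first_tooth_iff)
    qed
    moreover have "inv w c \<in> {1..n}"
    proof -
      have "c \<in> {1..n}" using c tooth_row(3) w_range[of i] index by auto
      then show ?thesis using permutes_in_image[OF permutes_inv[OF perm]] by simp
    qed
    ultimately show "c \<in> w ` {a \<in> {1..i}. w a < j}"
      using c by (intro image_eqI[of _ _ "inv w c"]) (simp_all add: w_inv)
  qed
  moreover have "inj_on w {a \<in> {1..i}. w a < j}"
    by (rule inj_on_subset[OF permutes_inj[OF perm]]) simp
  ultimately have "card {a \<in> {1..i}. a \<notin> column E j} = j - w i"
    by (metis card_atLeastLessThan card_image)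
  with gap_row show ?thesis by simp
qed

lemma orthodontic_sequence_step:
  assumes asc: "ascent_at_minimum n w i"
    and "orthodontic_sequence n (reduced_rothe n (w \<circ> transpose i (Suc i))) ss"
  shows "orthodontic_sequence n E ((i, int (w i), ascent_at_minimum.M n w i) # ss)"
proof -
  interpret ascent_at_minimum n w i by fact
  show ?thesis
    using orthodontic_sequence_first_tooth[OF tooth M_def, of ss] assms(2)
    unfolding reduced_rothe_v card_gap[OF asc] by simp
qed

text \<open>While the tooth has not reached the top of the gap, no column can be completed to an interval, because row
  \<open>i - 1\<close> lies in the gap and is empty in the whole reduced diagram. The same tooth is then moved up
  by one more row.\<close>

lemma next_tooth:
  assumes asc: "ascent_at_minimum n w i" and i: "1 < i" "w (i - 1) < j"
  shows "ascent_at_minimum.M n w i = {}"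
    and "first_tooth n (reduced_rothe n (w \<circ> transpose i (Suc i))) j (i - 1)"
proof -
  interpret ascent_at_minimum n w i by fact
  have gap: "i - 1 \<notin> column E c" for c
  proof
    assume mem: "i - 1 \<in> column E c"
    then have "c < w (i - 1)" by (auto simp: column_reduced_rothe mem_column_rothe split: if_splits)
    with i have "column E c = {}" using tooth by (simp add: first_tooth_iff)
    with mem show False by simp
  qed
  have t: "t (i - 1) = i - 1" using i(1) by (intro transpose_apply_other) auto
  show "M = {}"
  proof (rule equals0I)
    fix c assume "c \<in> M"
    then have "t ` column E c = {1..i}" by (simp add: M_def column_swap_rows)
    moreover have "i - 1 \<in> {1..i}" using i by auto
    ultimately obtain b where "b \<in> column E c" "t b = i - 1" by (metis imageE)
    then have "i - 1 \<in> column E c" using t by (metis transpose_involutory)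
    then show False using gap by simp
  qed
  then have col: "column (reduced_rothe n v) c = t ` column E c" for c
    by (simp add: reduced_rothe_v column_swap_rows)
  have mem: "b \<in> column (reduced_rothe n v) c \<longleftrightarrow> t b \<in> column E c" for b c
    by (subst inj_image_mem_iff[OF inj_transpose, symmetric, of _ _ i "Suc i"]) (simp add: col)
  have tooth': "Suc i \<in> column E j" "i \<notin> column E j"
    and least: "\<And>b. b \<in> missing_teeth n (column E j) \<Longrightarrow> i \<le> b"
    using tooth by (simp_all add: first_tooth_iff missing_teeth_def)
  show "first_tooth n (reduced_rothe n v) j (i - 1)"
    unfolding first_tooth_iff
  proof (intro conjI allI impI ballI)
    show "column (reduced_rothe n v) j \<noteq> {}" using tooth by (simp add: col first_tooth_iff)
    show "column (reduced_rothe n v) c = {}" if "c < j" for c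
      using that tooth by (simp add: col first_tooth_iff)
    show "i - 1 \<in> missing_teeth n (column (reduced_rothe n v) j)"
    proof -
      have "i - 1 \<in> {1..<n}" "Suc (i - 1) = i" using i index by auto
      with gap[of j] tooth' show ?thesis by (simp add: missing_teeth_def mem t)
    qed
    show "i - 1 \<le> b" if "b \<in> missing_teeth n (column (reduced_rothe n v) j)" for b
    proof (rule ccontr)
      assume "\<not> i - 1 \<le> b"
      then have b: "b < i - 1" by simp
      then have "t b = b" "t (Suc b) = Suc b" by (auto simp: transpose_def)
      with that have "b \<in> missing_teeth n (column E j)"
        by (simp add: missing_teeth_def mem)
      with least b show False by fastforce
    qed
  qed
qed

end

section \<open>Symmetry in the gap and the orthodontic formula\<close>

lemma orthodontic_sequence_exists:
  assumes "w permutes {1..n}"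
  shows "\<exists>ss. orthodontic_sequence n (reduced_rothe n w) ss"
  using assms
proof (induction rule: ascent_induct)
  case (step w)
  show ?case
  proof (cases "reduced_rothe n w = {}")
    case True
    then show ?thesis using orthodontic_sequence.stop by auto
  next
    case False
    then obtain j i where "first_tooth n (reduced_rothe n w) j i"
      by (rule first_tooth_exists)
    with step.hyps interpret rothe_tooth n w j i by unfold_locales
    show ?thesis
    proof (cases decreasing)
      case True
      then interpret asc: ascent_at_minimum n w i by (rule decreasing_ascent_at_minimum)
      obtain ss where "orthodontic_sequence n (reduced_rothe n asc.v) ss"
        using step.IH[OF asc.index asc.ascent] by (elim exE)
      then show ?thesis
        using orthodontic_sequence_step[OF asc.ascent_at_minimum_axioms] by (intro exI)
    next
      case False
      then obtain a where "ascent_without_132 n w a" by (rule not_decreasing)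
      then interpret asc: ascent_without_132 n w a .
      show ?thesis
        using step.IH[OF asc.index asc.ascent] by (simp only: asc.reduced_rothe_v_eq)
    qed
  qed
qed

definition steps :: "nat \<Rightarrow> (nat \<Rightarrow> nat) \<Rightarrow> (nat \<times> int \<times> nat set) list" where
  "steps n w = (THE ss. orthodontic_sequence n (reduced_rothe n w) ss)"

definition steps_value :: "(nat \<times> int \<times> nat set) list \<Rightarrow> xy_poly" where
  "steps_value ss = foldr (\<lambda>(i, j, M) f. pi_op i j (omega i M * f)) ss 1"

lemma steps_value_Nil: "steps_value [] = 1"
  and steps_value_Cons: "steps_value ((i, j, M) # ss) = pi_op i j (omega i M * steps_value ss)"
  by (simp_all add: steps_value_def)

lemma steps_eqI:
  assumes "orthodontic_sequence n (reduced_rothe n w) ss"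
  shows "steps n w = ss"
  unfolding steps_def
  by (rule the_equality) (use assms orthodontic_sequence_unique in blast)+

lemma orthodontic_sequence_steps:
  assumes "w permutes {1..n}"
  shows "orthodontic_sequence n (reduced_rothe n w) (steps n w)"
proof -
  obtain ss where "orthodontic_sequence n (reduced_rothe n w) ss"
    using orthodontic_sequence_exists[OF assms] by (elim exE)
  then show ?thesis using steps_eqI by simp
qed

lemma steps_empty:
  assumes "reduced_rothe n w = {}"
  shows "steps n w = []"
  by (rule steps_eqI) (simp add: assms orthodontic_sequence.stop)

lemma (in ascent_without_132) steps_v: "steps n v = steps n w"
  by (simp add: steps_def reduced_rothe_v_eq)

lemma (in rothe_tooth) steps_first:
  assumes "ascent_at_minimum n w i"
  shows "steps n w = (i, int (w i), ascent_at_minimum.M n w i) # steps n (w \<circ> transpose i (Suc i))"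
proof -
  interpret asc: ascent_at_minimum n w i by fact
  show ?thesis
    by (rule steps_eqI orthodontic_sequence_step orthodontic_sequence_steps assms asc.perm_v)+
qed

definition schubert_formula :: "nat \<Rightarrow> (nat \<Rightarrow> nat) \<Rightarrow> bool" where
  "schubert_formula n w \<longleftrightarrow> negate_y (double_schubert n w) =
     box_prod (rothe_intervals n w) * steps_value (steps n w)"

text \<open>The condition depends on \<open>w\<close> only through its reduced diagram: \<open>w a < j\<close> says that row \<open>a\<close> is missing from
  column \<open>j\<close>.\<close>

definition symmetric_in_gap :: "nat \<Rightarrow> (nat \<Rightarrow> nat) \<Rightarrow> bool" where
  "symmetric_in_gap n w \<longleftrightarrow> (\<forall>j i a. first_tooth n (reduced_rothe n w) j i \<longrightarrow> a \<in> {1..<i} \<longrightarrow>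
     w a < j \<longrightarrow> swap_x a (steps_value (steps n w)) = steps_value (steps n w))"

lemma (in ascent_at_minimum) negate_y_double_schubert:
  "negate_y (double_schubert n w) = divided_difference i (negate_y (double_schubert n v))"
  by (simp only: double_schubert_ascent[OF perm index ascent] negate_y_divided_difference)

text \<open>The interval factors of \<open>w\<close> are symmetric and leave the divided difference; the new box supplies exactly the
  linear factor that turns \<open>\<partial>\<^sub>i\<close> into \<open>\<pi>\<^sub>i\<close>.\<close>

lemma (in ascent_at_minimum) negate_y_double_schubert_formula:
  assumes "schubert_formula n v"
  shows "negate_y (double_schubert n w) = box_prod (rothe_intervals n w) *
    pi_op i (int (w i)) (omega i M * steps_value (steps n v))"
  using assms unfolding schubert_formula_def negate_y_double_schubert box_prod_v pi_op_def
  by (simp only: mult.assoc divided_difference_symmetric_mult[OF swap_x_box_prod])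

lemma pi_op_symmetric:
  assumes "swap_x i f = f"
  shows "pi_op i j f = f"
  unfolding pi_op_def
proof (rule divided_difference_unique)
  show "(xv i - xv (Suc i)) * f = (xv i + yv j) * f - swap_x i ((xv i + yv j) * f)"
    by (simp add: swap_x_ring_simps assms algebra_simps)
qed

lemma swap_x_cancel:
  assumes "swap_x i (p * g) = p * g" "swap_x i p = p" "p \<noteq> 0"
  shows "swap_x i g = g"
proof -
  have "p * swap_x i g = p * g" using assms(1,2) by (simp add: swap_x_ring_simps)
  with assms(3) show ?thesis by (metis mult_left_cancel)
qed

text \<open>The Schubert polynomial is symmetric, being a divided difference, and so are its interval factors; hence the
  remaining factor is symmetric as well.\<close>

lemma (in ascent_at_minimum) symmetric_if_schubert_formula:
  assumes "schubert_formula n w"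
  shows "swap_x i (steps_value (steps n w)) = steps_value (steps n w)"
proof (rule swap_x_cancel[OF _ swap_x_box_prod box_prod_nonzero])
  have "swap_x i (negate_y (double_schubert n w)) = negate_y (double_schubert n w)"
    by (simp only: negate_y_double_schubert swap_x_divided_difference)
  with assms show "swap_x i (box_prod (rothe_intervals n w) * steps_value (steps n w)) =
      box_prod (rothe_intervals n w) * steps_value (steps n w)"
    by (simp only: schubert_formula_def)
qed

text \<open>Induction along ascents first makes \<open>w\<close> decreasing on the gap, without changing the reduced
  diagram. Then the first orthodontic step moves the tooth from \<open>i + 1\<close> to \<open>i\<close>. If \<open>a < i - 1\<close>, it commutes with the swap
  of \<open>x\<^sub>a, x\<^sub>a\<^sub>+\<^sub>1\<close> and the remaining sequence is shorter. If \<open>a = i - 1\<close>, the second step is at \<open>a\<close>, and the braid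
  argument applies to the two steps together.\<close>

lemma symmetric_in_gap_if_fewer_steps:
  assumes "w permutes {1..n}"
    and "\<And>u. u permutes {1..n} \<Longrightarrow> length (steps n u) < length (steps n w) \<Longrightarrow>
      schubert_formula n u \<and> symmetric_in_gap n u"
  shows "symmetric_in_gap n w"
  using assms
proof (induction rule: ascent_induct)
  case (step w)
  show ?case
    unfolding symmetric_in_gap_def
  proof (intro allI impI)
    fix j i a
    assume first: "first_tooth n (reduced_rothe n w) j i" and a: "a \<in> {1..<i}" "w a < j"
    interpret rothe_tooth n w j i using step.hyps first by unfold_locales
    show "swap_x a (steps_value (steps n w)) = steps_value (steps n w)"
    proof (cases decreasing)
      case False
      then obtain b where b: "b \<in> {1..<i}" "w b < j" "ascent_without_132 n w b"
        by (rule not_decreasing)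
      interpret b: ascent_without_132 n w b by fact
      have "symmetric_in_gap n b.v"
        by (rule step.IH[OF b.index b.ascent]) (simp only: b.steps_v step.prems)
      moreover have "b.v a < j"
        using a b(1,2) gap_upward[of b] by (auto simp: transpose_def)
      ultimately show ?thesis
        using first a(1) unfolding symmetric_in_gap_def b.steps_v b.reduced_rothe_v_eq by blast
    next
      case True
      interpret asc: ascent_at_minimum n w i by (rule decreasing_ascent_at_minimum[OF True])
      note steps_w = steps_first[OF asc.ascent_at_minimum_axioms]
      \<comment> \<open>The gap reaches from \<open>a\<close> down to \<open>i\<close>.\<close>
      have upto: "w b < j" if "a \<le> b" "b \<le> i" for b
        using that
      proof (induction b rule: dec_induct)
        case (step b)
        then show ?case using gap_upward[of b] a by simp
      qed (rule a(2))
      have i: "1 < i" "w (i - 1) < j" using a upto[of "i - 1"] by auto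
      note next_tooth = next_tooth[OF asc.ascent_at_minimum_axioms i]
      have "schubert_formula n asc.v \<and> symmetric_in_gap n asc.v"
        by (rule step.prems[OF asc.perm_v]) (unfold steps_w, simp add: comp_def)
      then have sym_v: "symmetric_in_gap n asc.v" by simp
      show ?thesis
      proof (cases "a = i - 1")
        case False
        then have "a \<in> {1..<i - 1}" "Suc a < i" using a by auto
        moreover have "asc.v a < j"
          using a \<open>Suc a < i\<close> by (simp add: transpose_def)
        ultimately have "swap_x a (steps_value (steps n asc.v)) = steps_value (steps n asc.v)"
          using sym_v next_tooth(2) unfolding symmetric_in_gap_def by blast
        then show ?thesis
          unfolding steps_w steps_value_Cons
          using \<open>Suc a < i\<close> a
          by (intro swap_x_pi_op_distant) (simp_all add: swap_x_ring_simps swap_x_omega)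
      next
        case a_eq: True
        then have i_eq: "i = Suc a" using i by simp
        interpret nxt: rothe_tooth n asc.v j a
          using asc.perm_v next_tooth(2) a_eq by unfold_locales simp_all
        have dec_a: "w (Suc a) < w a"
          using True a unfolding decreasing_def by auto
        interpret next_asc: ascent_at_minimum n asc.v a
        proof (rule nxt.decreasing_ascent_at_minimum)
          show nxt.decreasing
            unfolding nxt.decreasing_def
            using True[unfolded decreasing_def] by (auto simp: i_eq transpose_def)
        qed
        note steps_v = nxt.steps_first[OF next_asc.ascent_at_minimum_axioms]
        \<comment> \<open>After the two steps rows \<open>i\<close> and \<open>i + 1\<close> hold the two gap values in decreasing order. Exchanging them
            gives \<open>u\<close>, which has an ascent at \<open>i\<close> and the same reduced diagram, so the formula for \<open>u\<close>
            yields the symmetry needed for the braid argument.\<close>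
        define u where "u = next_asc.v \<circ> transpose i (Suc i)"
        have u_i: "u i = w i" "u (Suc i) = w a"
          by (simp_all add: u_def i_eq transpose_def)
        have u_a: "u a = w (Suc i)" by (simp add: u_def i_eq transpose_def)
        have u_other: "u p = w p" if "p \<noteq> a" "p \<noteq> i" "p \<noteq> Suc i" for p
          using that by (simp add: u_def i_eq transpose_def)
        have perm_u: "u permutes {1..n}"
          unfolding u_def by (rule permutes_comp_transpose[OF next_asc.perm_v asc.index])
        interpret u: ascent_without_132 n u i
        proof
          show "u i < u (Suc i)" using dec_a u_i by (simp add: i_eq)
          show "u i < u p" if "p \<in> {1..<i}" for p
            using that asc.minimum[of p] asc.ascent u_other[of p]
            by (cases "p = a") (auto simp: u_i u_a)
          show "\<not> Suc i < inv u c" if "u i < c" "c < u (Suc i)" for c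
          proof
            assume less: "Suc i < inv u c"
            have "w (inv u c) = u (inv u c)" using less i_eq by (intro u_other[symmetric]) auto
            then have "w (inv u c) = c" by (simp add: permutes_inverses(1)[OF perm_u])
            then have "inv w c = inv u c" using asc.inv_w by metis
            moreover have "c < j" "c < w (Suc i)" "w i < c"
              using that a(2) tooth_row(1) by (simp_all add: u_i)
            moreover have "column E c = {}" using \<open>c < j\<close> first by (simp add: first_tooth_iff)
            ultimately show False
              using no_132_if_columns_empty[OF perm _ index, of c] less by simp
          qed
        qed (fact perm_u index)+
        have u_v: "u.v = next_asc.v" by (simp only: u_def comp_transpose_twice)
        have steps_u: "steps n u = steps n next_asc.v"
          using u.steps_v by (simp only: u_v)
        have "schubert_formula n u \<and> symmetric_in_gap n u"
          by (rule step.prems[OF perm_u]) (unfold steps_w steps_v steps_u, simp)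
        then have "swap_x i (steps_value (steps n next_asc.v)) = steps_value (steps n next_asc.v)"
          using u.symmetric_if_schubert_formula by (simp only: steps_u)
        then have "swap_x (Suc a) (omega a next_asc.M * steps_value (steps n next_asc.v)) =
            omega a next_asc.M * steps_value (steps n next_asc.v)"
          by (simp add: i_eq swap_x_ring_simps swap_x_omega)
        note sym = swap_x_pi_op_pi_op[OF this]
        have "omega i asc.M = 1" by (simp add: next_tooth(1) omega_def)
        then have value_w: "steps_value (steps n w) = pi_op (Suc a) (int (w i))
            (pi_op a (int (asc.v a)) (omega a next_asc.M * steps_value (steps n next_asc.v)))"
          unfolding steps_w steps_v steps_value_Cons by (simp only: mult_1 i_eq)
        show ?thesis unfolding value_w by (rule sym)
      qed
    qed
  qed
qed

text \<open>Here \<open>\<pi>\<^sub>i\<close> acts on a symmetric polynomial and therefore does nothing, matching the fact that no orthodontic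
  step takes place.\<close>

lemma (in ascent_without_132) schubert_formula_if_symmetric:
  assumes "schubert_formula n v"
    and "swap_x i (steps_value (steps n w)) = steps_value (steps n w)"
  shows "schubert_formula n w"
proof -
  have "omega i M = 1" by (simp add: M_empty omega_def)
  then show ?thesis
    using negate_y_double_schubert_formula[OF assms(1)]
    by (simp add: schubert_formula_def steps_v pi_op_symmetric[OF assms(2)])
qed

lemma (in rothe_tooth) schubert_formula_step:
  assumes "ascent_at_minimum n w i" "schubert_formula n (w \<circ> transpose i (Suc i))"
  shows "schubert_formula n w"
  unfolding schubert_formula_def steps_first[OF assms(1)] steps_value_Cons
  by (rule ascent_at_minimum.negate_y_double_schubert_formula[OF assms])

lemma schubert_formula_longest_perm:
  assumes "longest_perm n permutes {1..n}"
    "reduced_rothe n (longest_perm n) = {}"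
  shows "schubert_formula n (longest_perm n)"
proof -
  let ?B = "{(i, j). 1 \<le> i \<and> 1 \<le> j \<and> i + j \<le> n}"
  have inv: "inv (longest_perm n) = longest_perm n"
    by (rule inv_unique_comp) (auto simp: longest_perm_def fun_eq_iff)
  have "rothe_diagram n (longest_perm n) = ?B"
    unfolding rothe_diagram_def inv by (auto simp: longest_perm_def)
  moreover have "double_schubert n (longest_perm n) = (\<Prod>(i, j)\<in>?B. xv i - yv (int j))"
    by (rule double_schubert_eqI[OF assms(1)]) (rule is_double_schubert.longest)
  ultimately show ?thesis
    unfolding schubert_formula_def steps_empty[OF assms(2)] steps_value_Nil assms(2) Diff_empty
    by (simp add: box_prod_def negate_y_ring_simps split_beta)
qed

text \<open>The outer induction is on the number of orthodontic steps, the inner one along ascents: a step at an ascent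
  without 132 keeps the orthodontic sequence and only increases the length of the permutation.\<close>

lemma schubert_formula_and_symmetry:
  assumes "w permutes {1..n}"
  shows "schubert_formula n w \<and> symmetric_in_gap n w"
  using assms
proof (induction "length (steps n w)" arbitrary: w rule: less_induct)
  case less
  show ?case
    using less.prems less.hyps
  proof (induction rule: ascent_induct)
    case (step w)
    have sym: "symmetric_in_gap n w"
      by (rule symmetric_in_gap_if_fewer_steps[OF step.hyps]) (rule step.prems)
    have "schubert_formula n w"
    proof (cases "reduced_rothe n w = {}")
      case True
      show ?thesis
      proof (cases "w = longest_perm n")
        case longest: True
        show ?thesis
          using step.hyps True unfolding longest by (rule schubert_formula_longest_perm)
      next
        case False
        with step.hyps True obtain a where "ascent_without_132 n w a"
          by (rule empty_reduced_ascent)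
        then interpret asc: ascent_without_132 n w a .
        have "schubert_formula n asc.v"
          using step.IH[OF asc.index asc.ascent] step.prems by (simp only: asc.steps_v)
        then show ?thesis
          by (rule asc.schubert_formula_if_symmetric)
            (simp add: steps_empty[OF True] steps_value_Nil swap_x_ring_simps)
      qed
    next
      case False
      then obtain j i where first: "first_tooth n (reduced_rothe n w) j i"
        by (rule first_tooth_exists)
      interpret rothe_tooth n w j i using step.hyps first by unfold_locales
      show ?thesis
      proof (cases decreasing)
        case True
        then interpret asc: ascent_at_minimum n w i by (rule decreasing_ascent_at_minimum)
        have "schubert_formula n asc.v \<and> symmetric_in_gap n asc.v"
          by (rule step.prems[OF _ asc.perm_v])
            (unfold steps_first[OF asc.ascent_at_minimum_axioms], simp add: comp_def)
        then show ?thesis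
          by (intro schubert_formula_step[OF asc.ascent_at_minimum_axioms]) simp
      next
        case False
        then obtain a where a: "a \<in> {1..<i}" "w a < j" "ascent_without_132 n w a"
          by (rule not_decreasing)
        interpret asc: ascent_without_132 n w a by fact
        have "schubert_formula n asc.v"
          using step.IH[OF asc.index asc.ascent] step.prems by (simp only: asc.steps_v)
        moreover have "swap_x a (steps_value (steps n w)) = steps_value (steps n w)"
          using sym first a(1,2) unfolding symmetric_in_gap_def by blast
        ultimately show ?thesis by (rule asc.schubert_formula_if_symmetric)
      qed
    qed
    with sym show ?case by simp
  qed
qed

theorem corollary3p12:
  fixes n :: nat and w :: "nat \<Rightarrow> nat"
  assumes "w permutes {1..n}"
  shows "double_orthodontia_poly n (rothe_diagram n w) = negate_y (double_schubert n w)"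
  using schubert_formula_and_symmetry[OF assms]
  unfolding schubert_formula_def double_orthodontia_poly_def steps_def steps_value_def
    prod_omega_interval_columns[OF rothe_finite]
  by simp

end
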